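(* Let $(Y_i)_{i\ge 1}$ be independent real random variables with $E(Y_i)=\theta_i\in\Theta$ and $\mathrm{Var}(Y_i)=V(\theta_i)/\tau_i$, where $V(\theta)=\nu_0+\nu_1\theta+\nu_2\theta^2$. Assume: (A) $\limsup_{p\to\infty}\frac1p\sum_{i=1}^p \mathrm{Var}(Y_i)<\infty$; (B) $\limsup_{p\to\infty}\frac1p\sum_{i=1}^p \mathrm{Var}(Y_i)\,\theta_i^2<\infty$; (C) $\limsup_{p\to\infty}\frac1p\sum_{i=1}^p \mathrm{Var}(Y_i^2)<\infty$; (D) $\sup_i\left(\frac{\tau_i}{\tau_i+\nu_2}\right)^2<\infty$ and $\sup_i\left(\frac{\nu_1}{\tau_i+\nu_2}\right)^2<\infty$; (E) $\limsup_{p\to\infty}\frac{1}{p^{1-\varepsilon}}E\left(\max_{1\le i\le p}Y_i^2\right)<\infty$ for some $\varepsilon>0$. For each $p$ let $\hat{\boldsymbol\theta}^{\mathrm{SM}}$ be the semiparametric URE shrinkage estimator. Then for any shrinkage estimator $\hat{\boldsymbol\theta}^{\hat{\mathbf b},\hat\mu}$, $\hat\theta^{\hat{\mathbf b},\hat\mu}_i=(1-\hat b_i)Y_i+\hat b_i\hat\mu$, where the (possibly data-dependent) $\hat{\mathbf b}\in[0,1]^p$ satisfies Requirement (MON) and the (possibly data-dependent) $\hat\mu$ satisfies $|\hat\mu|\le\max_{1\le i\le p}|Y_i|$, we always have $$\lim_{p\to\infty}P\left(l_p(\boldsymbol\theta,\hat{\boldsymbol\theta}^{\mathrm{SM}})\ge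 l_p(\boldsymbol\theta,\hat{\boldsymbol\theta}^{\hat{\mathbf b},\hat\mu})+\varepsilon\right)=0\qquad\text{for any }\varepsilon>0$$ and $$\limsup_{p\to\infty}\left[R_p(\boldsymbol\theta,\hat{\boldsymbol\theta}^{\mathrm{SM}})-R_p(\boldsymbol\theta,\hat{\boldsymbol\theta}^{\hat{\mathbf b},\hat\mu})\right]\le0.$$
   Context: $\nu_0,\nu_1,\nu_2$ are known real constants, $\Theta\subseteq\{\theta\in\mathbb R:V(\theta)\ge0\}$ is the set of allowable mean parameters, $(\theta_i)_{i\ge1}$ is a fixed (deterministic) sequence in $\Theta$, and $(\tau_i)_{i\ge1}$ is a fixed known sequence of positive reals with $\tau_i+\nu_2\ne0$. For each $p$ only $Y_1,\dots,Y_p$ are used. Requirement (MON) for $\mathbf b=(b_1,\dots,b_p)$: $b_i\le b_j$ for all $i,j\in\{1,\dots,p\}$ with $\tau_i\ge\tau_j$. Loss and risk: $l_p(\boldsymbol\theta,\hat{\boldsymbol\theta})=\frac1p\sum_{i=1}^p(\hat\theta_i-\theta_i)^2$, $R_p(\boldsymbol\theta,\hat{\boldsymbol\theta})=E[l_p(\boldsymbol\theta,\hat{\boldsymbol\theta})]$. Unbiased risk estimate: $\mathrm{URE}(\mathbf b,\mu)=\frac1p\sum_{i=1}^p\left[b_i^2(Y_i-\mu)^2+(1-2b_i)\frac{V(Y_i)}{\tau_i+\nu_2}\right]$. Semiparametric URE shrinkage estimator: $\hat\theta^{\mathrm{SM}}_i=(1-\hat b_i^{\mathrm{SM}})Y_i+\hat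 b_i^{\mathrm{SM}}\hat\mu^{\mathrm{SM}}$, where $(\hat{\mathbf b}^{\mathrm{SM}},\hat\mu^{\mathrm{SM}})$ is a minimizer of $\mathrm{URE}(\mathbf b,\mu)$ subject to $\mathbf b\in[0,1]^p$, Requirement (MON), and $\mu\in[-\max_i|Y_i|,\max_i|Y_i|]\cap\Theta$. It is understood that such a (measurable) minimizer exists for each $p$.
   Formalization: The formal theorem assumes in addition that Θ is an interval or that the competitor's location μ̂ always lies in Θ; for Θ with gaps, such as {−1,1}, and μ̂ outside Θ the claim as stated is false. *)

theory Defs
  imports "HOL-Probability.Probability"
begin

text \<open>Sequences are indexed by the positive naturals; the problem of size \<open>p\<close> uses the
  indices \<open>{1..p}\<close> only. Index \<open>0\<close> and size \<open>p = 0\<close> are never meaningful.\<close>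

definition quad_var :: "real \<Rightarrow> real \<Rightarrow> real \<Rightarrow> real \<Rightarrow> real" where
  "quad_var \<nu>0 \<nu>1 \<nu>2 x = \<nu>0 + \<nu>1 * x + \<nu>2 * x\<^sup>2"

definition MON :: "(nat \<Rightarrow> real) \<Rightarrow> nat \<Rightarrow> (nat \<Rightarrow> real) \<Rightarrow> bool" where
  "MON \<tau> p b \<longleftrightarrow> (\<forall>i\<in>{1..p}. \<forall>j\<in>{1..p}. \<tau> i \<ge> \<tau> j \<longrightarrow> b i \<le> b j)"

definition max_abs :: "nat \<Rightarrow> (nat \<Rightarrow> real) \<Rightarrow> real" where
  "max_abs p y = Max ((\<lambda>i. \<bar>y i\<bar>) ` {1..p})"

definition shrink :: "(nat \<Rightarrow> real) \<Rightarrow> real \<Rightarrow> (nat \<Rightarrow> real) \<Rightarrow> nat \<Rightarrow> real" where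
  "shrink b \<mu> y i = (1 - b i) * y i + b i * \<mu>"

definition loss :: "nat \<Rightarrow> (nat \<Rightarrow> real) \<Rightarrow> (nat \<Rightarrow> real) \<Rightarrow> real" where
  "loss p \<theta> t = (1 / real p) * (\<Sum>i=1..p. (t i - \<theta> i)\<^sup>2)"

definition risk :: "'a measure \<Rightarrow> nat \<Rightarrow> (nat \<Rightarrow> real) \<Rightarrow> ('a \<Rightarrow> nat \<Rightarrow> real) \<Rightarrow> real" where
  "risk M p \<theta> T = prob_space.expectation M (\<lambda>\<omega>. loss p \<theta> (T \<omega>))"

definition URE :: "real \<Rightarrow> real \<Rightarrow> real \<Rightarrow> (nat \<Rightarrow> real) \<Rightarrow> nat \<Rightarrow> (nat \<Rightarrow> real)
    \<Rightarrow> (nat \<Rightarrow> real) \<Rightarrow> real \<Rightarrow> real" where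
  "URE \<nu>0 \<nu>1 \<nu>2 \<tau> p y b \<mu> =
     (1 / real p) * (\<Sum>i=1..p. (b i)\<^sup>2 * (y i - \<mu>)\<^sup>2
                       + (1 - 2 * b i) * (quad_var \<nu>0 \<nu>1 \<nu>2 (y i) / (\<tau> i + \<nu>2)))"

definition is_SM :: "real \<Rightarrow> real \<Rightarrow> real \<Rightarrow> real set \<Rightarrow> (nat \<Rightarrow> real) \<Rightarrow> nat \<Rightarrow> (nat \<Rightarrow> real)
    \<Rightarrow> (nat \<Rightarrow> real) \<Rightarrow> real \<Rightarrow> bool" where
  "is_SM \<nu>0 \<nu>1 \<nu>2 \<Theta> \<tau> p y b \<mu> \<longleftrightarrow>
     is_arg_min (\<lambda>(b, \<mu>). URE \<nu>0 \<nu>1 \<nu>2 \<tau> p y b \<mu>)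
       (\<lambda>(b, \<mu>). (\<forall>i\<in>{1..p}. b i \<in> {0..1}) \<and> MON \<tau> p b
                  \<and> \<mu> \<in> {- max_abs p y .. max_abs p y} \<inter> \<Theta>)
       (b, \<mu>)"

definition sample :: "(nat \<Rightarrow> 'a \<Rightarrow> real) \<Rightarrow> nat \<Rightarrow> 'a \<Rightarrow> nat \<Rightarrow> real" where
  "sample Y p \<omega> = (\<lambda>i\<in>{1..p}. Y i \<omega>)"

text \<open>A choice of shrinkage factors and shrinkage location for every \<open>p\<close> is a pair of maps
  taking the observed vector \<open>y = (y\<^sub>1, \<dots>, y\<^sub>p)\<close> to \<open>b p y\<close> and \<open>\<mu> p y\<close>; both have to be
  measurable in the data.\<close>

definition data_measurable ::
  "(nat \<Rightarrow> (nat \<Rightarrow> real) \<Rightarrow> nat \<Rightarrow> real) \<Rightarrow> (nat \<Rightarrow> (nat \<Rightarrow> real) \<Rightarrow> real) \<Rightarrow> bool" where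
  "data_measurable b \<mu> \<longleftrightarrow>
     (\<forall>p\<ge>1. (\<forall>i\<in>{1..p}. (\<lambda>y. b p y i) \<in> borel_measurable (PiM {1..p} (\<lambda>_. borel)))
           \<and> \<mu> p \<in> borel_measurable (PiM {1..p} (\<lambda>_. borel)))"

definition shrink_est :: "(nat \<Rightarrow> 'a \<Rightarrow> real) \<Rightarrow> (nat \<Rightarrow> (nat \<Rightarrow> real) \<Rightarrow> nat \<Rightarrow> real)
    \<Rightarrow> (nat \<Rightarrow> (nat \<Rightarrow> real) \<Rightarrow> real) \<Rightarrow> nat \<Rightarrow> 'a \<Rightarrow> nat \<Rightarrow> real" where
  "shrink_est Y b \<mu> p \<omega> =
     shrink (b p (sample Y p \<omega>)) (\<mu> p (sample Y p \<omega>)) (sample Y p \<omega>)"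

end

theory Submission
  imports Defs
begin

text \<open>
  The point is that the unbiased risk estimate is uniformly close to the loss over \<^emph>\<open>all\<close> admissible
  pairs \<open>(b, \<mu>)\<close>, with an error that vanishes in expectation. A minimizer of the former is then a
  near minimizer of the latter, whatever the competitor and however it depends on the data.

  Expanding the squares gives
  \<open>URE - loss = (1/p) * (\<Sum> Z\<^sub>i - 2 * \<Sum> b\<^sub>i * U\<^sub>i - 2 * \<mu> * \<Sum> b\<^sub>i * X\<^sub>i)\<close> (lemma \<open>URE_minus_loss\<close>), where
  \<open>X\<^sub>i = Y\<^sub>i - \<theta>\<^sub>i\<close>, and where \<open>Z\<^sub>i\<close> and \<open>U\<^sub>i\<close> are functions of \<open>Y\<^sub>i\<close> that have mean zero because the
  variance is quadratic in the mean. Their second moments are controlled by the averages in the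
  hypotheses (lemma \<open>resid_moments\<close>), so that the sums of these moments grow at most linearly in \<open>p\<close>.

  The coefficients \<open>b\<^sub>i\<close> may depend on the data, but they decrease along any ordering of the indices by
  increasing \<open>\<tau>\<close>. Summation by parts therefore bounds \<open>\<bar>\<Sum> b\<^sub>i * x\<^sub>i\<bar>\<close> by the largest absolute partial sum
  of the \<open>x\<^sub>i\<close> in that ordering (lemma \<open>MON_weighted_sum_le\<close>), a quantity free of \<open>b\<close>. By a maximal
  inequality for sums of independent centred variables (lemma \<open>L2_maximal_inequality\<close>) its second
  moment is at most four times the sum of the variances, that is \<open>O(p)\<close>. Together with
  \<open>\<bar>\<mu>\<bar> \<le> max \<bar>Y\<^sub>i\<bar>\<close> and a second moment of that maximum of order \<open>p powr (1 - \<delta>)\<close>, the error is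
  \<open>O(p powr (- 1 / 2) + p powr (- \<delta> / 2))\<close> in expectation.

  If \<open>\<Theta>\<close> is an interval, the competing location may fall outside of \<open>\<Theta>\<close> and so outside of the region
  over which the estimate is minimized. It can then be replaced by a point of \<open>\<Theta>\<close> that lies between it
  and all of the means; this raises the loss by no more than an error of the same kind, since \<open>b\<close> and
  \<open>b\<^sup>2\<close> are both monotone (lemmas \<open>ex_allowed_location\<close> and \<open>loss_comparison\<close>).
\<close>

section \<open>Largest partial sums of a sequence\<close>

definition max_psum :: "nat \<Rightarrow> (nat \<Rightarrow> real) \<Rightarrow> real" where
  "max_psum n x = Max ((\<lambda>k. \<bar>\<Sum>j<k. x j\<bar>) ` {..n})"

lemma max_psum_0 [simp]: "max_psum 0 x = 0"
  by (simp add: max_psum_def)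

lemma max_psum_Suc: "max_psum (Suc n) x = max (max_psum n x) \<bar>\<Sum>j<Suc n. x j\<bar>"
  unfolding max_psum_def atMost_Suc image_insert by (subst Max_insert) (auto simp: max.commute)

lemma abs_psum_le_max_psum: "k \<le> n \<Longrightarrow> \<bar>\<Sum>j<k. x j\<bar> \<le> max_psum n x"
  unfolding max_psum_def by (intro Max_ge) auto

lemma max_psum_nonneg: "0 \<le> max_psum n x"
  using abs_psum_le_max_psum[of 0 n x] by simp

lemma max_psum_cong: "(\<And>j. j < n \<Longrightarrow> x j = y j) \<Longrightarrow> max_psum n x = max_psum n y"
  unfolding max_psum_def by (intro arg_cong[where f = Max] image_cong refl arg_cong[where f = abs] sum.cong) auto

lemma max_psum_le_sum_abs: "max_psum n x \<le> (\<Sum>j<n. \<bar>x j\<bar>)"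
proof (induction n)
  case (Suc n)
  have "\<bar>\<Sum>j<Suc n. x j\<bar> \<le> (\<Sum>j<Suc n. \<bar>x j\<bar>)" by (rule sum_abs)
  moreover have "(\<Sum>j<n. \<bar>x j\<bar>) \<le> (\<Sum>j<Suc n. \<bar>x j\<bar>)" by simp
  ultimately show ?case using Suc unfolding max_psum_Suc by linarith
qed simp

lemma borel_measurable_max_psum:
  assumes "\<And>j. j < n \<Longrightarrow> X j \<in> borel_measurable N"
  shows "(\<lambda>\<omega>. max_psum n (\<lambda>j. X j \<omega>)) \<in> borel_measurable N"
  unfolding max_psum_def using assms
  by (intro borel_measurable_Max borel_measurable_abs borel_measurable_sum) auto

text \<open>
  A maximal inequality that holds path by path, with no probability in it: the subtracted sum is a
  discrete stochastic integral \<open>\<Sum> f\<^sub>k * x\<^sub>k\<close> whose integrand \<open>f\<^sub>k\<close> depends on \<open>x\<^sub>0, \<dots>, x\<^bsub>k-1\<^esub>\<close> only, hence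
  has mean zero for independent centred increments. The induction step rests on
  \<open>\<bar>s + x\<bar> \<ge> \<bar>s\<bar> + sgn s * x\<close> when the maximum \<open>m\<close> stays, and on \<open>(m - \<bar>s + x\<bar>)\<^sup>2 \<ge> 0\<close> when it grows.
\<close>

lemma max_psum_pathwise:
  "(max_psum n x)\<^sup>2 / 2 \<le> max_psum n x * \<bar>\<Sum>j<n. x j\<bar>
      - (\<Sum>k<n. max_psum k x * sgn (\<Sum>j<k. x j) * x k)"
proof (induction n)
  case (Suc n)
  define m s where "m = max_psum n x" and "s = (\<Sum>j<n. x j)"
  have m: "m \<ge> 0" "\<bar>s\<bar> \<le> m"
    using max_psum_nonneg abs_psum_le_max_psum[of n n x] by (auto simp: m_def s_def)
  have abs_step: "\<bar>s\<bar> + sgn s * x n \<le> \<bar>s + x n\<bar>"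
    by (cases s "0 :: real" rule: linorder_cases) (auto)
  have *: "m * \<bar>s\<bar> + m * sgn s * x n \<le> m * \<bar>s + x n\<bar>"
    using mult_left_mono[OF abs_step m(1)] by (simp add: algebra_simps)
  have **: "(max m r)\<^sup>2 / 2 - max m r * r \<le> m\<^sup>2 / 2 - m * r" for r :: real
  proof (cases "r \<le> m")
    case False
    have "0 \<le> (m - r)\<^sup>2" by simp
    with False show ?thesis by (simp add: power2_eq_square field_simps max_def)
  qed (simp add: max_def)
  show ?case
    using Suc * **[of "\<bar>s + x n\<bar>"] unfolding max_psum_Suc by (simp add: m_def[symmetric] s_def[symmetric])
qed simp

lemma max_psum_sq_le:
  "(max_psum n x)\<^sup>2 \<le> 4 * (\<Sum>j<n. x j)\<^sup>2 - 4 * (\<Sum>k<n. max_psum k x * sgn (\<Sum>j<k. x j) * x k)"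
proof -
  have "0 \<le> (max_psum n x / 2 - \<bar>\<Sum>j<n. x j\<bar>)\<^sup>2" by simp
  then have "max_psum n x * \<bar>\<Sum>j<n. x j\<bar> \<le> (max_psum n x)\<^sup>2 / 4 + (\<Sum>j<n. x j)\<^sup>2"
    by (simp add: power2_eq_square algebra_simps)
  then show ?thesis using max_psum_pathwise[of n x] by simp
qed

text \<open>
  Summation by parts writes the weighted sum as a combination of partial sums with nonnegative
  weights \<open>c\<^sub>k - c\<^bsub>k+1\<^esub>\<close> and \<open>c\<^bsub>n-1\<^esub>\<close>, whose total is \<open>c\<^sub>0 \<le> 1\<close>.
\<close>

lemma antitone_weighted_sum_le:
  assumes "\<And>i j. i \<le> j \<Longrightarrow> j < n \<Longrightarrow> c j \<le> c i" and c: "\<And>i. i < n \<Longrightarrow> c i \<in> {0..1}"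
  shows "\<bar>\<Sum>j<n. c j * x j\<bar> \<le> max_psum n x"
proof (cases n)
  case (Suc m)
  let ?S = "\<lambda>k. \<Sum>j<k. x j"
  have *: "\<bar>(\<Sum>j<Suc k. c j * x j) - c k * ?S (Suc k)\<bar> \<le> (c 0 - c k) * max_psum n x"
    if "k \<le> m" for k using that
  proof (induction k)
    case (Suc k)
    have "(\<Sum>j<Suc (Suc k). c j * x j) - c (Suc k) * ?S (Suc (Suc k))
      = ((\<Sum>j<Suc k. c j * x j) - c k * ?S (Suc k)) + (c k - c (Suc k)) * ?S (Suc k)"
      by (simp add: algebra_simps)
    also have "\<bar>\<dots>\<bar> \<le> (c 0 - c k) * max_psum n x + (c k - c (Suc k)) * max_psum n x"
    proof (intro abs_triangle_ineq[THEN order_trans] add_mono)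
      show "\<bar>(c k - c (Suc k)) * ?S (Suc k)\<bar> \<le> (c k - c (Suc k)) * max_psum n x"
        using assms(1)[of k "Suc k"] abs_psum_le_max_psum[of "Suc k" n x] Suc.prems \<open>n = Suc m\<close>
        by (auto simp: abs_mult intro!: mult_left_mono)
    qed (use Suc in auto)
    finally show ?case by (simp add: algebra_simps)
  qed simp
  have "\<bar>\<Sum>j<n. c j * x j\<bar> \<le> (c 0 - c m) * max_psum n x + c m * \<bar>?S n\<bar>"
  proof -
    have "\<bar>(\<Sum>j<n. c j * x j)\<bar> \<le> \<bar>(\<Sum>j<n. c j * x j) - c m * ?S n\<bar> + \<bar>c m * ?S n\<bar>" by linarith
    moreover have "\<bar>c m * ?S n\<bar> = c m * \<bar>?S n\<bar>" using c[of m] Suc by (simp add: abs_mult)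
    ultimately show ?thesis using *[of m] Suc by simp
  qed
  also have "\<dots> \<le> (c 0 - c m) * max_psum n x + c m * max_psum n x"
    using c[of m] Suc abs_psum_le_max_psum[of n n x] by (intro add_left_mono mult_left_mono) auto
  also have "\<dots> \<le> 1 * max_psum n x"
    using c[of 0] Suc max_psum_nonneg[of n x] mult_right_mono[of "c 0" 1 "max_psum n x"]
    by (auto simp: algebra_simps)
  finally show ?thesis by simp
qed simp

section \<open>Sums with monotone weights\<close>

lemma ex_sorting_enumeration:
  fixes \<tau> :: "nat \<Rightarrow> real"
  shows "\<exists>\<sigma>. bij_betw \<sigma> {..<p} {1..p} \<and> (\<forall>i j. i \<le> j \<longrightarrow> j < p \<longrightarrow> \<tau> (\<sigma> i) \<le> \<tau> (\<sigma> j))"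
proof -
  define xs where "xs = sort_key \<tau> [1..<Suc p]"
  have "bij_betw (nth xs) {..<p} {1..p}"
    by (rule bij_betw_nth) (auto simp: xs_def simp del: upt_Suc)
  moreover have "sorted (map \<tau> xs)" "length xs = p" by (simp_all add: xs_def del: upt_Suc)
  then have "\<forall>i j. i \<le> j \<longrightarrow> j < p \<longrightarrow> \<tau> (xs ! i) \<le> \<tau> (xs ! j)"
    by (auto simp: sorted_iff_nth_mono)
  ultimately show ?thesis by blast
qed

text \<open>
  The right-hand side does not mention \<open>b\<close>: it bounds the sum for all admissible weights at once, and
  in particular for weights computed from the data.
\<close>

lemma MON_weighted_sum_le:
  assumes \<sigma>: "bij_betw \<sigma> {..<p} {1..p}" "\<And>i j. i \<le> j \<Longrightarrow> j < p \<Longrightarrow> \<tau> (\<sigma> i) \<le> \<tau> (\<sigma> j)"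
    and b: "MON \<tau> p b" "\<forall>i\<in>{1..p}. b i \<in> {0..1}"
  shows "\<bar>\<Sum>i=1..p. b i * x i\<bar> \<le> max_psum p (\<lambda>j. x (\<sigma> j))"
proof -
  have "(\<Sum>i=1..p. b i * x i) = (\<Sum>j<p. b (\<sigma> j) * x (\<sigma> j))"
    using sum.reindex_bij_betw[OF \<sigma>(1), of "\<lambda>i. b i * x i"] by simp
  moreover have in_range: "\<sigma> j \<in> {1..p}" if "j < p" for j
    using \<sigma>(1) that by (auto simp: bij_betw_def)
  have "\<bar>\<Sum>j<p. b (\<sigma> j) * x (\<sigma> j)\<bar> \<le> max_psum p (\<lambda>j. x (\<sigma> j))"
    using b \<sigma>(2) in_range unfolding MON_def
    by (intro antitone_weighted_sum_le) (meson le_less_trans, blast)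
  ultimately show ?thesis by simp
qed

section \<open>A maximal inequality in mean square\<close>

context prob_space
begin

text \<open>
  Doob's inequality with its constant 4, in the case of sums of independent variables. It is the
  expectation of the pathwise inequality \<open>max_psum_sq_le\<close>, in which the stochastic integral drops out.
  The orthogonality of the increments, obtained on the way, gives the last two claims.
\<close>

lemma L2_maximal_inequality:
  fixes X :: "nat \<Rightarrow> 'a \<Rightarrow> real"
  assumes ind: "indep_vars (\<lambda>_. borel) X {..<n}"
    and sq: "\<And>j. j < n \<Longrightarrow> integrable M (\<lambda>\<omega>. (X j \<omega>)\<^sup>2)"
    and zero: "\<And>j. j < n \<Longrightarrow> expectation (X j) = 0"
  shows "integrable M (\<lambda>\<omega>. (max_psum n (\<lambda>j. X j \<omega>))\<^sup>2)"
    and "expectation (\<lambda>\<omega>. (max_psum n (\<lambda>j. X j \<omega>))\<^sup>2) \<le> 4 * (\<Sum>j<n. expectation (\<lambda>\<omega>. (X j \<omega>)\<^sup>2))"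
    and "expectation (\<lambda>\<omega>. (\<Sum>j<n. X j \<omega>)\<^sup>2) = (\<Sum>j<n. expectation (\<lambda>\<omega>. (X j \<omega>)\<^sup>2))"
    and "integrable M (\<lambda>\<omega>. (\<Sum>j<n. X j \<omega>)\<^sup>2)"
proof -
  have meas [measurable]: "X j \<in> borel_measurable M" if "j < n" for j
    using ind that by (auto simp: indep_vars_def)
  have intX: "integrable M (X j)" if "j < n" for j
    using square_integrable_imp_integrable[OF meas sq] that by auto
  \<comment> \<open>Any function of the variables before \<open>k\<close> is independent of the centred \<open>X k\<close>. This is used for the
    partial sums (orthogonality) and for the integrand of the pathwise inequality.\<close>
  have past: "integrable M (\<lambda>\<omega>. f (\<lambda>j\<in>{..<k}. X j \<omega>) * X k \<omega>) \<and>
              expectation (\<lambda>\<omega>. f (\<lambda>j\<in>{..<k}. X j \<omega>) * X k \<omega>) = 0"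
    if "k < n" and f: "f \<in> borel_measurable (PiM {..<k} (\<lambda>_. borel))"
      and fle: "\<And>\<omega>. \<bar>f (\<lambda>j\<in>{..<k}. X j \<omega>)\<bar> \<le> (\<Sum>j<k. \<bar>X j \<omega>\<bar>)" for k f
  proof -
    have "indep_var (PiM {..<k} (\<lambda>_. borel)) (\<lambda>\<omega>. restrict (\<lambda>i. X i \<omega>) {..<k})
                    (PiM {k} (\<lambda>_. borel)) (\<lambda>\<omega>. restrict (\<lambda>i. X i \<omega>) {k})"
      using ind \<open>k < n\<close> by (intro indep_var_restrict) auto
    from indep_var_compose[OF this f, of "\<lambda>g. g k" borel]
    have iv: "indep_var borel (\<lambda>\<omega>. f (\<lambda>j\<in>{..<k}. X j \<omega>)) borel (X k)"
      by (simp add: o_def)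
    have "integrable M (\<lambda>\<omega>. \<Sum>j<k. \<bar>X j \<omega>\<bar>)"
      using intX \<open>k < n\<close> by (intro Bochner_Integration.integrable_sum integrable_abs) auto
    then have intf: "integrable M (\<lambda>\<omega>. f (\<lambda>j\<in>{..<k}. X j \<omega>))"
    proof (rule Bochner_Integration.integrable_bound)
      show "(\<lambda>\<omega>. f (\<lambda>j\<in>{..<k}. X j \<omega>)) \<in> borel_measurable M"
        using iv by (auto simp: indep_var_def indep_vars_def split: bool.splits dest: spec[of _ True])
    qed (use fle in \<open>auto intro!: AE_I2 order_trans[OF fle]\<close>)
    show ?thesis
      using indep_var_lebesgue_integral[OF iv intf intX] indep_var_integrable[OF iv intf intX]
        zero \<open>k < n\<close> by simp
  qed
  have S: "integrable M (\<lambda>\<omega>. (\<Sum>j<k. X j \<omega>)\<^sup>2) \<and>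
     expectation (\<lambda>\<omega>. (\<Sum>j<k. X j \<omega>)\<^sup>2) = (\<Sum>j<k. expectation (\<lambda>\<omega>. (X j \<omega>)\<^sup>2))" if "k \<le> n" for k
    using that
  proof (induction k)
    case (Suc k)
    have "integrable M (\<lambda>\<omega>. (\<lambda>g. \<Sum>j<k. g j) (\<lambda>j\<in>{..<k}. X j \<omega>) * X k \<omega>) \<and>
          expectation (\<lambda>\<omega>. (\<lambda>g. \<Sum>j<k. g j) (\<lambda>j\<in>{..<k}. X j \<omega>) * X k \<omega>) = 0"
      using Suc.prems by (intro past) (auto intro!: sum_abs borel_measurable_sum measurable_component_singleton)
    then have cross: "integrable M (\<lambda>\<omega>. (\<Sum>j<k. X j \<omega>) * X k \<omega>)"
        "expectation (\<lambda>\<omega>. (\<Sum>j<k. X j \<omega>) * X k \<omega>) = 0" by simp_all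
    have "(\<Sum>j<Suc k. X j \<omega>)\<^sup>2 = (\<Sum>j<k. X j \<omega>)\<^sup>2 + 2 * ((\<Sum>j<k. X j \<omega>) * X k \<omega>) + (X k \<omega>)\<^sup>2" for \<omega>
      by (simp add: power2_eq_square algebra_simps)
    then show ?case using Suc cross sq[of k] by simp
  qed simp
  show "expectation (\<lambda>\<omega>. (\<Sum>j<n. X j \<omega>)\<^sup>2) = (\<Sum>j<n. expectation (\<lambda>\<omega>. (X j \<omega>)\<^sup>2))"
    and iS: "integrable M (\<lambda>\<omega>. (\<Sum>j<n. X j \<omega>)\<^sup>2)" using S by auto
  let ?D = "\<lambda>k \<omega>. max_psum k (\<lambda>j. X j \<omega>) * sgn (\<Sum>j<k. X j \<omega>) * X k \<omega>"
  have D: "integrable M (?D k) \<and> expectation (?D k) = 0" if "k < n" for k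
  proof -
    have "integrable M (\<lambda>\<omega>. (\<lambda>g. max_psum k g * sgn (\<Sum>j<k. g j)) (\<lambda>j\<in>{..<k}. X j \<omega>) * X k \<omega>) \<and>
          expectation (\<lambda>\<omega>. (\<lambda>g. max_psum k g * sgn (\<Sum>j<k. g j)) (\<lambda>j\<in>{..<k}. X j \<omega>) * X k \<omega>) = 0"
    proof (intro past \<open>k < n\<close>)
      show "(\<lambda>g. max_psum k g * sgn (\<Sum>j<k. g j)) \<in> borel_measurable (PiM {..<k} (\<lambda>_. borel))"
        by (intro borel_measurable_times borel_measurable_max_psum borel_measurable_sgn
              borel_measurable_sum measurable_component_singleton) auto
      show "\<bar>max_psum k (\<lambda>j\<in>{..<k}. X j \<omega>) * sgn (\<Sum>j<k. (\<lambda>j\<in>{..<k}. X j \<omega>) j)\<bar> \<le> (\<Sum>j<k. \<bar>X j \<omega>\<bar>)" for \<omega>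
        using max_psum_le_sum_abs[of k "\<lambda>j. X j \<omega>"] max_psum_nonneg[of k "\<lambda>j. X j \<omega>"]
        by (auto simp: abs_mult sgn_if sum_nonneg cong: max_psum_cong)
    qed
    then show ?thesis by (simp cong: max_psum_cong)
  qed
  have iR: "integrable M (\<lambda>\<omega>. 4 * (\<Sum>j<n. X j \<omega>)\<^sup>2 - 4 * (\<Sum>k<n. ?D k \<omega>))"
    using iS D by (intro Bochner_Integration.integrable_diff integrable_mult_right
        Bochner_Integration.integrable_sum) auto
  show iM: "integrable M (\<lambda>\<omega>. (max_psum n (\<lambda>j. X j \<omega>))\<^sup>2)"
    using iR
  proof (rule Bochner_Integration.integrable_bound)
    show "(\<lambda>\<omega>. (max_psum n (\<lambda>j. X j \<omega>))\<^sup>2) \<in> borel_measurable M"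
      by (intro borel_measurable_power borel_measurable_max_psum meas)
  qed (auto intro!: AE_I2 max_psum_sq_le[THEN order_trans])
  have "expectation (\<lambda>\<omega>. (max_psum n (\<lambda>j. X j \<omega>))\<^sup>2)
      \<le> expectation (\<lambda>\<omega>. 4 * (\<Sum>j<n. X j \<omega>)\<^sup>2 - 4 * (\<Sum>k<n. ?D k \<omega>))"
    using iM iR max_psum_sq_le by (intro integral_mono) auto
  also have "\<dots> = 4 * (\<Sum>j<n. expectation (\<lambda>\<omega>. (X j \<omega>)\<^sup>2))"
  proof -
    have iD: "integrable M (\<lambda>\<omega>. \<Sum>k<n. ?D k \<omega>)" using D by (intro Bochner_Integration.integrable_sum) auto
    have "expectation (\<lambda>\<omega>. \<Sum>k<n. ?D k \<omega>) = (\<Sum>k<n. expectation (?D k))"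
      using D by (intro Bochner_Integration.integral_sum) auto
    also have "\<dots> = 0" using D by (intro sum.neutral) auto
    finally show ?thesis using iS iD S[of n] by simp
  qed
  finally show "expectation (\<lambda>\<omega>. (max_psum n (\<lambda>j. X j \<omega>))\<^sup>2) \<le> 4 * (\<Sum>j<n. expectation (\<lambda>\<omega>. (X j \<omega>)\<^sup>2))" .
qed

end

section \<open>Loss and unbiased risk estimate for a fixed observation\<close>

lemma abs_le_max_abs: "i \<in> {1..p} \<Longrightarrow> \<bar>y i\<bar> \<le> max_abs p y"
  unfolding max_abs_def by (intro Max_ge) auto

lemma max_abs_nonneg: "1 \<le> p \<Longrightarrow> 0 \<le> max_abs p y"
  using abs_le_max_abs[of 1 p y] by auto

text \<open>
  For an observation \<open>y\<close> with mean \<open>h\<close> this combines the two centred variables \<open>y - h\<close> and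
  \<open>y\<^sup>2 - E y\<^sup>2\<close>, as \<open>h\<^sup>2 + V(h) / t\<close> is the second moment. The values \<open>c = 1\<close> and \<open>c = 2\<close> give the two
  fluctuations \<open>V(y) / (t + \<nu>2) - (y - h) * y\<close> and \<open>V(y) / (t + \<nu>2) - (y - h)\<^sup>2\<close> in which the
  unbiased risk estimate differs from the loss; in this form both are seen to have mean zero.
\<close>

definition resid :: "real \<Rightarrow> real \<Rightarrow> real \<Rightarrow> real \<Rightarrow> real \<Rightarrow> real \<Rightarrow> real \<Rightarrow> real" where
  "resid \<nu>0 \<nu>1 \<nu>2 t h c y =
     (\<nu>1 / (t + \<nu>2) + c * h) * (y - h)
     - t / (t + \<nu>2) * (y\<^sup>2 - (h\<^sup>2 + quad_var \<nu>0 \<nu>1 \<nu>2 h / t))"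

lemma resid_1:
  assumes "t \<noteq> 0" "t + \<nu>2 \<noteq> 0"
  shows "resid \<nu>0 \<nu>1 \<nu>2 t h 1 y = quad_var \<nu>0 \<nu>1 \<nu>2 y / (t + \<nu>2) - (y - h) * y"
proof -
  define s where "s = t + \<nu>2"
  have s: "s \<noteq> 0" "\<nu>2 = s - t" using assms by (auto simp: s_def)
  show ?thesis
    unfolding resid_def quad_var_def s_def[symmetric]
    unfolding s(2) using s(1) assms(1)
    by (simp add: field_simps power2_eq_square)
qed

lemma resid_2:
  assumes "t \<noteq> 0" "t + \<nu>2 \<noteq> 0"
  shows "resid \<nu>0 \<nu>1 \<nu>2 t h 2 y = quad_var \<nu>0 \<nu>1 \<nu>2 y / (t + \<nu>2) - (y - h)\<^sup>2"
proof -
  have "resid \<nu>0 \<nu>1 \<nu>2 t h 2 y = resid \<nu>0 \<nu>1 \<nu>2 t h 1 y + h * (y - h)"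
    unfolding resid_def by (simp add: algebra_simps)
  then show ?thesis using resid_1[OF assms] by (simp add: power2_eq_square algebra_simps)
qed

lemma URE_minus_loss:
  assumes "\<And>i. i \<in> {1..p} \<Longrightarrow> \<tau> i \<noteq> 0" "\<And>i. i \<in> {1..p} \<Longrightarrow> \<tau> i + \<nu>2 \<noteq> 0"
  shows "URE \<nu>0 \<nu>1 \<nu>2 \<tau> p y b \<mu> - loss p \<theta> (shrink b \<mu> y) =
    ((\<Sum>i=1..p. resid \<nu>0 \<nu>1 \<nu>2 (\<tau> i) (\<theta> i) 2 (y i))
     - 2 * (\<Sum>i=1..p. b i * resid \<nu>0 \<nu>1 \<nu>2 (\<tau> i) (\<theta> i) 1 (y i))
     - 2 * \<mu> * (\<Sum>i=1..p. b i * (y i - \<theta> i))) / real p"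
proof -
  have "(b i)\<^sup>2 * (y i - \<mu>)\<^sup>2 + (1 - 2 * b i) * (quad_var \<nu>0 \<nu>1 \<nu>2 (y i) / (\<tau> i + \<nu>2))
          - (shrink b \<mu> y i - \<theta> i)\<^sup>2
      = resid \<nu>0 \<nu>1 \<nu>2 (\<tau> i) (\<theta> i) 2 (y i) - 2 * (b i * resid \<nu>0 \<nu>1 \<nu>2 (\<tau> i) (\<theta> i) 1 (y i))
        - 2 * \<mu> * (b i * (y i - \<theta> i))" if "i \<in> {1..p}" for i
  proof -
    have "(b i)\<^sup>2 * (y i - \<mu>)\<^sup>2 + (1 - 2 * b i) * w - ((1 - b i) * y i + b i * \<mu> - \<theta> i)\<^sup>2
      = (w - (y i - \<theta> i)\<^sup>2) - 2 * (b i * (w - (y i - \<theta> i) * y i)) - 2 * \<mu> * (b i * (y i - \<theta> i))" for w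
      by (simp add: algebra_simps power2_eq_square)
    then show ?thesis
      unfolding resid_1[OF assms[OF that]] resid_2[OF assms[OF that]] shrink_def .
  qed
  then have "(\<Sum>i=1..p. (b i)\<^sup>2 * (y i - \<mu>)\<^sup>2 + (1 - 2 * b i) * (quad_var \<nu>0 \<nu>1 \<nu>2 (y i) / (\<tau> i + \<nu>2))
          - (shrink b \<mu> y i - \<theta> i)\<^sup>2)
      = (\<Sum>i=1..p. resid \<nu>0 \<nu>1 \<nu>2 (\<tau> i) (\<theta> i) 2 (y i)
           - 2 * (b i * resid \<nu>0 \<nu>1 \<nu>2 (\<tau> i) (\<theta> i) 1 (y i)) - 2 * \<mu> * (b i * (y i - \<theta> i)))"
    by (intro sum.cong) auto
  then show ?thesis
    unfolding URE_def loss_def sum_subtractf sum_distrib_left[symmetric]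
    by (simp add: diff_divide_distrib[symmetric])
qed

text \<open>Weights \<open>b * (1 - b)\<close>, which need not be monotone, are thus a difference of admissible ones.\<close>

lemma MON_square:
  assumes "MON \<tau> p b" "\<forall>i\<in>{1..p}. b i \<in> {0..1}"
  shows "MON \<tau> p (\<lambda>i. (b i)\<^sup>2)" "\<forall>i\<in>{1..p}. (b i)\<^sup>2 \<in> {0..1}"
  using assms by (auto simp: MON_def power_mono power_le_one)

text \<open>
  The effect of moving the location from \<open>\<mu>\<close> to \<open>m\<close>, split into a part driven by the noise \<open>y - \<theta>\<close>, which
  has monotone weights, and a systematic part, which favours \<open>m\<close> if \<open>m\<close> is closer to the means.
\<close>

lemma loss_diff_location:
  "loss p \<theta> (shrink b m y) - loss p \<theta> (shrink b \<mu> y) =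
     (2 * (\<mu> - m) * ((\<Sum>i=1..p. (b i)\<^sup>2 * (y i - \<theta> i)) - (\<Sum>i=1..p. b i * (y i - \<theta> i)))
      - (\<Sum>i=1..p. (b i)\<^sup>2 * ((\<mu> - m) * ((\<mu> - \<theta> i) + (m - \<theta> i))))) / real p"
proof -
  have "(shrink b m y i - \<theta> i)\<^sup>2 - (shrink b \<mu> y i - \<theta> i)\<^sup>2
     = 2 * (\<mu> - m) * ((b i)\<^sup>2 * (y i - \<theta> i) - b i * (y i - \<theta> i))
       - (b i)\<^sup>2 * ((\<mu> - m) * ((\<mu> - \<theta> i) + (m - \<theta> i)))" for i
    unfolding shrink_def by (simp add: algebra_simps power2_eq_square)
  then have "(\<Sum>i=1..p. (shrink b m y i - \<theta> i)\<^sup>2 - (shrink b \<mu> y i - \<theta> i)\<^sup>2)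
     = (\<Sum>i=1..p. 2 * (\<mu> - m) * ((b i)\<^sup>2 * (y i - \<theta> i) - b i * (y i - \<theta> i))
       - (b i)\<^sup>2 * ((\<mu> - m) * ((\<mu> - \<theta> i) + (m - \<theta> i))))" by simp
  then show ?thesis
    unfolding loss_def sum_subtractf sum_distrib_left[symmetric]
    by (simp add: diff_divide_distrib[symmetric])
qed

text \<open>
  Since \<open>\<mu>\<close> is not in the interval \<open>\<Theta>\<close>, it lies on one side of all of \<open>\<Theta>\<close>. The witness is the point
  nearest to \<open>\<mu>\<close> among the means and \<open>m0\<close>. A projection to \<open>\<Theta>\<close> itself might not exist, because \<open>\<Theta>\<close>
  need not be closed; \<open>m0\<close> keeps the witness within \<open>[-A, A]\<close>.
\<close>

lemma ex_allowed_location: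
  fixes \<mu> :: real and p :: nat
  assumes \<Theta>: "is_interval \<Theta>" "\<And>i. i \<in> {1..p} \<Longrightarrow> \<theta> i \<in> \<Theta>"
    and m0: "m0 \<in> {- A..A} \<inter> \<Theta>" and \<mu>: "\<bar>\<mu>\<bar> \<le> A" "\<mu> \<notin> \<Theta>"
  shows "\<exists>m\<in>{- A..A} \<inter> \<Theta>. \<forall>i\<in>{1..p}. 0 \<le> (\<mu> - m) * ((\<mu> - \<theta> i) + (m - \<theta> i))"
proof -
  have no_gap: "\<not> (x \<le> \<mu> \<and> \<mu> \<le> y)" if "x \<in> \<Theta>" "y \<in> \<Theta>" for x y
    using \<Theta>(1) \<mu>(2) that unfolding is_interval_1 by blast
  have one_side: "x < \<mu> \<longleftrightarrow> y < \<mu>" if "x \<in> \<Theta>" "y \<in> \<Theta>" for x y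
    using no_gap[of x y] no_gap[of y x] no_gap[of x x] no_gap[of y y] that by linarith
  define H where "H = insert m0 (\<theta> ` {1..p})"
  have H: "finite H" "H \<noteq> {}" "H \<subseteq> \<Theta>" "m0 \<in> H" "\<And>i. i \<in> {1..p} \<Longrightarrow> \<theta> i \<in> H"
    using \<Theta>(2) m0 by (auto simp: H_def)
  show ?thesis
  proof (cases "m0 < \<mu>")
    case True
    then have lt: "x < \<mu>" if "x \<in> H" for x using that one_side H(3) m0 by blast
    have ge: "x \<le> Max H" if "x \<in> H" for x using H that by simp
    have "Max H \<in> H" using H by simp
    then have "Max H \<in> \<Theta>" "Max H < \<mu>" using lt H(3) by auto
    then have "Max H \<in> {- A..A} \<inter> \<Theta>" using ge[OF H(4)] m0 \<mu>(1) by auto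
    moreover have "0 \<le> (\<mu> - Max H) * ((\<mu> - \<theta> i) + (Max H - \<theta> i))" if "i \<in> {1..p}" for i
      using lt[OF H(5)[OF that]] ge[OF H(5)[OF that]] \<open>Max H < \<mu>\<close> by (intro mult_nonneg_nonneg) auto
    ultimately show ?thesis by blast
  next
    case False
    then have lt: "\<mu> < x" if "x \<in> H" for x
      using that one_side[of x m0] H(3) m0 \<mu>(2) by (metis IntD2 linorder_neqE subsetD)
    have ge: "Min H \<le> x" if "x \<in> H" for x using H that by simp
    have "Min H \<in> H" using H by simp
    then have "Min H \<in> \<Theta>" "\<mu> < Min H" using lt H(3) by auto
    then have "Min H \<in> {- A..A} \<inter> \<Theta>" using ge[OF H(4)] m0 \<mu>(1) by auto
    moreover have "0 \<le> (\<mu> - Min H) * ((\<mu> - \<theta> i) + (Min H - \<theta> i))" if "i \<in> {1..p}" for i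
      using lt[OF H(5)[OF that]] ge[OF H(5)[OF that]] \<open>\<mu> < Min H\<close> by (intro mult_nonpos_nonpos) auto
    ultimately show ?thesis by blast
  qed
qed

text \<open>
  Everything that the minimality of the risk estimate says about the loss, for one fixed observation.
  The numbers \<open>DU\<close> and \<open>DX\<close> bound the two fluctuation sums uniformly over the admissible weights, so the
  competitor \<open>(b, \<mu>)\<close> may depend on the observation in any way. The uniform gap \<open>G\<close> between estimate and
  loss enters twice, and moving \<open>\<mu>\<close> into \<open>\<Theta>\<close> costs at most \<open>8 * max_abs p y * DX / p\<close>.
\<close>

lemma loss_comparison:
  assumes p: "1 \<le> p"
    and \<tau>: "\<And>i. i \<in> {1..p} \<Longrightarrow> \<tau> i \<noteq> 0" "\<And>i. i \<in> {1..p} \<Longrightarrow> \<tau> i + \<nu>2 \<noteq> 0"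
    and \<theta>: "\<And>i. i \<in> {1..p} \<Longrightarrow> \<theta> i \<in> \<Theta>"
    and SM: "is_SM \<nu>0 \<nu>1 \<nu>2 \<Theta> \<tau> p y b0 \<mu>0"
    and b: "MON \<tau> p b" "\<forall>i\<in>{1..p}. b i \<in> {0..1}"
    and \<mu>: "\<bar>\<mu>\<bar> \<le> max_abs p y" "is_interval \<Theta> \<or> \<mu> \<in> \<Theta>"
    and DU: "\<And>b. MON \<tau> p b \<Longrightarrow> \<forall>i\<in>{1..p}. b i \<in> {0..1} \<Longrightarrow>
               \<bar>\<Sum>i=1..p. b i * resid \<nu>0 \<nu>1 \<nu>2 (\<tau> i) (\<theta> i) 1 (y i)\<bar> \<le> DU"
    and DX: "\<And>b. MON \<tau> p b \<Longrightarrow> \<forall>i\<in>{1..p}. b i \<in> {0..1} \<Longrightarrow> \<bar>\<Sum>i=1..p. b i * (y i - \<theta> i)\<bar> \<le> DX"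
  shows "loss p \<theta> (shrink b0 \<mu>0 y) \<le> loss p \<theta> (shrink b \<mu> y)
     + (2 * \<bar>\<Sum>i=1..p. resid \<nu>0 \<nu>1 \<nu>2 (\<tau> i) (\<theta> i) 2 (y i)\<bar> + 4 * DU + 12 * (max_abs p y * DX)) / real p"
proof -
  define A Z where "A = max_abs p y" and "Z = (\<Sum>i=1..p. resid \<nu>0 \<nu>1 \<nu>2 (\<tau> i) (\<theta> i) 2 (y i))"
  define G where "G = (\<bar>Z\<bar> + 2 * DU + 2 * (A * DX)) / real p"
  define L where "L b \<mu> = loss p \<theta> (shrink b \<mu> y)" for b \<mu>
  define feasible where "feasible b \<mu> \<longleftrightarrow>
    (\<forall>i\<in>{1..p}. b i \<in> {0..1}) \<and> MON \<tau> p b \<and> \<mu> \<in> {- A..A} \<inter> \<Theta>" for b \<mu>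
  have A0: "A \<ge> 0" using max_abs_nonneg[OF p] by (simp add: A_def)
  have feas0: "feasible b0 \<mu>0"
    and opt: "\<And>b \<mu>. feasible b \<mu> \<Longrightarrow> URE \<nu>0 \<nu>1 \<nu>2 \<tau> p y b0 \<mu>0 \<le> URE \<nu>0 \<nu>1 \<nu>2 \<tau> p y b \<mu>"
    using SM unfolding is_SM_def is_arg_min_def feasible_def A_def by (auto simp: not_less)
  have close: "\<bar>URE \<nu>0 \<nu>1 \<nu>2 \<tau> p y b \<mu> - L b \<mu>\<bar> \<le> G" if "feasible b \<mu>" for b \<mu>
  proof -
    have b: "MON \<tau> p b" "\<forall>i\<in>{1..p}. b i \<in> {0..1}" and \<mu>: "\<bar>\<mu>\<bar> \<le> A"
      using that by (auto simp: feasible_def)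
    have "\<bar>\<mu> * (\<Sum>i=1..p. b i * (y i - \<theta> i))\<bar> \<le> A * DX"
      unfolding abs_mult using DX[OF b] \<mu> A0 by (intro mult_mono) auto
    then have "\<bar>Z - 2 * (\<Sum>i=1..p. b i * resid \<nu>0 \<nu>1 \<nu>2 (\<tau> i) (\<theta> i) 1 (y i))
        - 2 * \<mu> * (\<Sum>i=1..p. b i * (y i - \<theta> i))\<bar> \<le> \<bar>Z\<bar> + 2 * DU + 2 * (A * DX)"
      using DU[OF b] by (simp only: mult.assoc)
    moreover have "URE \<nu>0 \<nu>1 \<nu>2 \<tau> p y b \<mu> - L b \<mu> =
        (Z - 2 * (\<Sum>i=1..p. b i * resid \<nu>0 \<nu>1 \<nu>2 (\<tau> i) (\<theta> i) 1 (y i))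
         - 2 * \<mu> * (\<Sum>i=1..p. b i * (y i - \<theta> i))) / real p"
      unfolding L_def Z_def by (rule URE_minus_loss) (use \<tau> in auto)
    ultimately show ?thesis
      unfolding G_def by (simp add: divide_right_mono)
  qed
  have SM_feasible: "L b0 \<mu>0 \<le> L b m + 2 * G" if "feasible b m" for m
    using opt[OF that] close[OF that] close[OF feas0] by linarith
  have "\<exists>m. feasible b m \<and> L b m \<le> L b \<mu> + 8 * (A * DX) / real p"
  proof (cases "\<mu> \<in> \<Theta>")
    case True
    have "0 \<le> DX" using DX[OF b] by (meson abs_ge_zero order_trans)
    moreover have "feasible b \<mu>" using True b \<mu>(1) by (auto simp: feasible_def A_def)
    ultimately show ?thesis using A0 by (intro exI[of _ \<mu>]) simp
  next
    case False
    then obtain m where m: "m \<in> {- A..A} \<inter> \<Theta>"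
      "\<And>i. i \<in> {1..p} \<Longrightarrow> 0 \<le> (\<mu> - m) * ((\<mu> - \<theta> i) + (m - \<theta> i))"
      using ex_allowed_location[of \<Theta> p \<theta> \<mu>0 A \<mu>] \<theta> \<mu> feas0 unfolding feasible_def A_def by blast
    define W where "W = (\<Sum>i=1..p. (b i)\<^sup>2 * (y i - \<theta> i)) - (\<Sum>i=1..p. b i * (y i - \<theta> i))"
    have "\<bar>W\<bar> \<le> 2 * DX"
      using DX[OF MON_square[OF b]] DX[OF b] unfolding W_def by linarith
    moreover have "\<bar>\<mu> - m\<bar> \<le> 2 * A" using m(1) \<mu>(1) by (auto simp: A_def)
    ultimately have "\<bar>\<mu> - m\<bar> * \<bar>W\<bar> \<le> (2 * A) * (2 * DX)"
      using A0 by (intro mult_mono) auto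
    then have "(\<mu> - m) * W \<le> 4 * (A * DX)"
      using abs_ge_self[of "(\<mu> - m) * W"] unfolding abs_mult by linarith
    moreover have "0 \<le> (\<Sum>i=1..p. (b i)\<^sup>2 * ((\<mu> - m) * ((\<mu> - \<theta> i) + (m - \<theta> i))))"
      by (intro sum_nonneg mult_nonneg_nonneg[OF zero_le_power2 m(2)])
    ultimately have "L b m - L b \<mu> \<le> (8 * (A * DX)) / real p"
      unfolding L_def loss_diff_location W_def[symmetric] mult.assoc by (intro divide_right_mono) linarith+
    then show ?thesis using b m(1) by (intro exI[of _ m]) (auto simp: feasible_def)
  qed
  then have "L b0 \<mu>0 \<le> L b \<mu> + 8 * (A * DX) / real p + 2 * G"
    using SM_feasible by fastforce
  also have "\<dots> = L b \<mu> + (2 * \<bar>Z\<bar> + 4 * DU + 12 * (A * DX)) / real p"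
    unfolding G_def by (simp add: add_divide_distrib)
  finally show ?thesis by (simp add: L_def A_def Z_def)
qed

section \<open>Moments and vanishing error terms\<close>

lemma max_abs_sq_le_Max: "1 \<le> p \<Longrightarrow> (max_abs p y)\<^sup>2 \<le> Max ((\<lambda>i. (y i)\<^sup>2) ` {1..p})"
proof -
  assume "1 \<le> p"
  then have "max_abs p y \<in> (\<lambda>i. \<bar>y i\<bar>) ` {1..p}"
    unfolding max_abs_def by (intro Max_in) auto
  then obtain i where "i \<in> {1..p}" "max_abs p y = \<bar>y i\<bar>" by auto
  then show ?thesis by (auto intro!: Max_ge)
qed

lemma Max_sq_le_sum: "1 \<le> (p :: nat) \<Longrightarrow> Max ((\<lambda>i. (y i :: real)\<^sup>2) ` {1..p}) \<le> (\<Sum>i=1..p. (y i)\<^sup>2)"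
  by (subst Max_le_iff) (auto intro!: member_le_sum)

lemma max_abs_sample: "max_abs p (sample Y p \<omega>) = max_abs p (\<lambda>i. Y i \<omega>)"
  unfolding max_abs_def sample_def by (intro arg_cong[where f = Max] image_cong) auto

text \<open>
  The arithmetic-geometric mean inequality with weights that are powers of \<open>p\<close>. It replaces
  products by squares, so that only second moments have to be computed; the exponent \<open>a\<close> is chosen to
  balance the growth rates of the two squares.
\<close>

lemma young_with_power:
  fixes x y p a :: real
  assumes "0 < p"
  shows "2 * (x * y) / p \<le> x\<^sup>2 * p powr (- a) + y\<^sup>2 * p powr (a - 2)"
proof -
  have "- a / 2 + - a / 2 = - a" "(a - 2) / 2 + (a - 2) / 2 = a - 2" "- a / 2 + (a - 2) / 2 = - 1"
    by (simp_all add: field_simps)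
  then have e: "p powr (- a / 2) * p powr (- a / 2) = p powr (- a)"
    "p powr ((a - 2) / 2) * p powr ((a - 2) / 2) = p powr (a - 2)"
    "p powr (- a / 2) * p powr ((a - 2) / 2) = 1 / p"
    unfolding powr_add[symmetric] using assms by (simp_all add: powr_minus_divide)
  have "0 \<le> (x * p powr (- a / 2) - y * p powr ((a - 2) / 2))\<^sup>2" by simp
  also have "\<dots> = x\<^sup>2 * (p powr (- a / 2) * p powr (- a / 2)) + y\<^sup>2 * (p powr ((a - 2) / 2) * p powr ((a - 2) / 2))
     - 2 * (x * y) * (p powr (- a / 2) * p powr ((a - 2) / 2))"
    by (simp add: power2_eq_square algebra_simps)
  finally show ?thesis unfolding e by simp
qed

lemma limsup_finite_imp_eventually_le:
  assumes "limsup (\<lambda>p. ereal (f p)) < \<infinity>"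
  shows "\<exists>K\<ge>0. eventually (\<lambda>p. f p \<le> K) sequentially"
proof -
  obtain n :: nat where "limsup (\<lambda>p. ereal (f p)) < ereal (real n)"
    using assms less_PInf_Ex_of_nat by auto
  from Limsup_lessD[OF this] have "eventually (\<lambda>p. f p \<le> real n) sequentially"
    by eventually_elim simp
  then show ?thesis by (intro exI[of _ "real n"]) simp
qed

lemma SUP_finite_imp_le:
  assumes "(SUP i\<in>I. ereal (f i)) < \<infinity>"
  shows "\<exists>K\<ge>0. \<forall>i\<in>I. f i \<le> K"
proof -
  obtain n :: nat where "(SUP i\<in>I. ereal (f i)) < ereal (real n)"
    using assms less_PInf_Ex_of_nat by auto
  then have "f i \<le> real n" if "i \<in> I" for i
    using SUP_lessD[OF _ that, of "\<lambda>i. ereal (f i)" "ereal (real n)"] by simp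
  then show ?thesis by (intro exI[of _ "real n"]) simp
qed

context prob_space
begin

text \<open>
  The maximal inequality along an enumeration \<open>\<sigma>\<close> of the index set; the one used below sorts by \<open>\<tau>\<close>.
\<close>

lemma L2_maximal_enumeration:
  fixes X :: "nat \<Rightarrow> 'a \<Rightarrow> real"
  assumes ind: "indep_vars (\<lambda>_. borel) X {1..p}"
    and sq: "\<And>i. i \<in> {1..p} \<Longrightarrow> integrable M (\<lambda>\<omega>. (X i \<omega>)\<^sup>2)"
    and zero: "\<And>i. i \<in> {1..p} \<Longrightarrow> expectation (X i) = 0"
    and \<sigma>: "bij_betw \<sigma> {..<p} {1..p}"
  shows "integrable M (\<lambda>\<omega>. (max_psum p (\<lambda>j. X (\<sigma> j) \<omega>))\<^sup>2)"
    and "expectation (\<lambda>\<omega>. (max_psum p (\<lambda>j. X (\<sigma> j) \<omega>))\<^sup>2) \<le> 4 * (\<Sum>i=1..p. expectation (\<lambda>\<omega>. (X i \<omega>)\<^sup>2))"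
    and "integrable M (\<lambda>\<omega>. (\<Sum>i=1..p. X i \<omega>)\<^sup>2)"
    and "expectation (\<lambda>\<omega>. (\<Sum>i=1..p. X i \<omega>)\<^sup>2) = (\<Sum>i=1..p. expectation (\<lambda>\<omega>. (X i \<omega>)\<^sup>2))"
proof -
  have ran: "\<sigma> j \<in> {1..p}" if "j < p" for j using \<sigma> that by (auto simp: bij_betw_def)
  have "inj_on \<sigma> {..<p}" using \<sigma> by (simp add: bij_betw_def)
  then have "disjoint_family_on (\<lambda>j. {\<sigma> j}) {..<p}"
    by (auto simp: disjoint_family_on_def inj_on_def)
  then have "indep_vars (\<lambda>j. PiM {\<sigma> j} (\<lambda>_. borel)) (\<lambda>j \<omega>. restrict (\<lambda>i. X i \<omega>) {\<sigma> j}) {..<p}"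
    using ran by (intro indep_vars_restrict[OF ind]) auto
  from indep_vars_compose2[OF this, of "\<lambda>j g. g (\<sigma> j)" "\<lambda>_. borel"]
  have ind': "indep_vars (\<lambda>_. borel) (\<lambda>j. X (\<sigma> j)) {..<p}" by simp
  note L2 = L2_maximal_inequality[OF ind' sq[OF ran] zero[OF ran]]
  have re: "(\<Sum>j<p. g (\<sigma> j)) = (\<Sum>i=1..p. g i)" for g :: "nat \<Rightarrow> real"
    using sum.reindex_bij_betw[OF \<sigma>, of g] by simp
  show "integrable M (\<lambda>\<omega>. (max_psum p (\<lambda>j. X (\<sigma> j) \<omega>))\<^sup>2)" using L2(1) by blast
  show "expectation (\<lambda>\<omega>. (max_psum p (\<lambda>j. X (\<sigma> j) \<omega>))\<^sup>2) \<le> 4 * (\<Sum>i=1..p. expectation (\<lambda>\<omega>. (X i \<omega>)\<^sup>2))"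
    using L2(2) re[of "\<lambda>i. expectation (\<lambda>\<omega>. (X i \<omega>)\<^sup>2)"] by simp
  show "integrable M (\<lambda>\<omega>. (\<Sum>i=1..p. X i \<omega>)\<^sup>2)"
    using L2(4) re[of "\<lambda>i. X i \<omega>" for \<omega>] by simp
  show "expectation (\<lambda>\<omega>. (\<Sum>i=1..p. X i \<omega>)\<^sup>2) = (\<Sum>i=1..p. expectation (\<lambda>\<omega>. (X i \<omega>)\<^sup>2))"
    using L2(3) re[of "\<lambda>i. X i \<omega>" for \<omega>] re[of "\<lambda>i. expectation (\<lambda>\<omega>. (X i \<omega>)\<^sup>2)"] by simp
qed

text \<open>
  The bound is \<open>(u + v - w)\<^sup>2 \<le> 3 * (u\<^sup>2 + v\<^sup>2 + w\<^sup>2)\<close> applied to the three summands with factors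
  \<open>\<nu>1 / (t + \<nu>2)\<close>, \<open>c * h\<close> and \<open>t / (t + \<nu>2)\<close>; each term on the right is one whose average over the
  indices is assumed to stay bounded.
\<close>

lemma resid_moments:
  fixes Y :: "'a \<Rightarrow> real"
  assumes Y: "integrable M Y" "integrable M (\<lambda>\<omega>. (Y \<omega>)\<^sup>2)" "integrable M (\<lambda>\<omega>. ((Y \<omega>)\<^sup>2)\<^sup>2)"
    and mean: "expectation Y = h" and var: "variance Y = quad_var \<nu>0 \<nu>1 \<nu>2 h / t"
    and K: "(t / (t + \<nu>2))\<^sup>2 \<le> K1" "(\<nu>1 / (t + \<nu>2))\<^sup>2 \<le> K2" and c: "c\<^sup>2 \<le> 4"
  shows "integrable M (\<lambda>\<omega>. (resid \<nu>0 \<nu>1 \<nu>2 t h c (Y \<omega>))\<^sup>2)"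
    and "expectation (\<lambda>\<omega>. resid \<nu>0 \<nu>1 \<nu>2 t h c (Y \<omega>)) = 0"
    and "expectation (\<lambda>\<omega>. (resid \<nu>0 \<nu>1 \<nu>2 t h c (Y \<omega>))\<^sup>2)
      \<le> 3 * (K2 * variance Y + 4 * (variance Y * h\<^sup>2) + K1 * variance (\<lambda>\<omega>. (Y \<omega>)\<^sup>2))"
proof -
  define q where "q = expectation (\<lambda>\<omega>. (Y \<omega>)\<^sup>2)"
  define d a where "d = \<nu>1 / (t + \<nu>2)" and "a = t / (t + \<nu>2)"
  have [measurable]: "Y \<in> borel_measurable M" using Y(1) by simp
  have q: "h\<^sup>2 + quad_var \<nu>0 \<nu>1 \<nu>2 h / t = q"
    using variance_eq[OF Y(1,2)] mean var by (simp add: q_def)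
  have R: "resid \<nu>0 \<nu>1 \<nu>2 t h c y = (d + c * h) * (y - h) - a * (y\<^sup>2 - q)" for y
    unfolding resid_def q d_def a_def ..
  have iX: "integrable M (\<lambda>\<omega>. (Y \<omega> - h)\<^sup>2)"
    using Y(1,2) by (simp add: power2_diff)
  have iQ: "integrable M (\<lambda>\<omega>. ((Y \<omega>)\<^sup>2 - q)\<^sup>2)"
    using Y(2,3) by (simp add: power2_diff[of "(_::real)\<^sup>2"])
  let ?B = "\<lambda>\<omega>. 3 * (K2 * (Y \<omega> - h)\<^sup>2 + 4 * ((Y \<omega> - h)\<^sup>2 * h\<^sup>2) + K1 * ((Y \<omega>)\<^sup>2 - q)\<^sup>2)"
  have le: "(resid \<nu>0 \<nu>1 \<nu>2 t h c y)\<^sup>2 \<le> 3 * (K2 * (y - h)\<^sup>2 + 4 * ((y - h)\<^sup>2 * h\<^sup>2) + K1 * (y\<^sup>2 - q)\<^sup>2)" for y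
  proof -
    have three: "(u + v - w)\<^sup>2 \<le> 3 * (u\<^sup>2 + v\<^sup>2 + w\<^sup>2)" for u v w :: real
      using zero_le_power2[of "u - v"] zero_le_power2[of "u + w"] zero_le_power2[of "v + w"]
      by (simp add: power2_eq_square algebra_simps)
    have "(resid \<nu>0 \<nu>1 \<nu>2 t h c y)\<^sup>2 = (d * (y - h) + c * (h * (y - h)) - a * (y\<^sup>2 - q))\<^sup>2"
      unfolding R by (simp add: algebra_simps)
    also have "\<dots> \<le> 3 * (d\<^sup>2 * (y - h)\<^sup>2 + c\<^sup>2 * (h * (y - h))\<^sup>2 + a\<^sup>2 * (y\<^sup>2 - q)\<^sup>2)"
      using three[of "d * (y - h)" "c * (h * (y - h))" "a * (y\<^sup>2 - q)"] by (simp only: power_mult_distrib)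
    also have "\<dots> \<le> 3 * (K2 * (y - h)\<^sup>2 + 4 * (h * (y - h))\<^sup>2 + K1 * (y\<^sup>2 - q)\<^sup>2)"
      using K c by (intro mult_left_mono add_mono mult_right_mono) (auto simp: d_def a_def)
    finally show ?thesis by (simp add: power_mult_distrib mult.commute)
  qed
  have iB: "integrable M ?B"
    by (intro integrable_mult_right Bochner_Integration.integrable_add integrable_mult_left iX iQ)
  show sq: "integrable M (\<lambda>\<omega>. (resid \<nu>0 \<nu>1 \<nu>2 t h c (Y \<omega>))\<^sup>2)"
    using iB
  proof (rule Bochner_Integration.integrable_bound)
    show "(\<lambda>\<omega>. (resid \<nu>0 \<nu>1 \<nu>2 t h c (Y \<omega>))\<^sup>2) \<in> borel_measurable M"
      unfolding R by measurable
  qed (auto intro!: AE_I2 le[THEN order_trans])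
  show "expectation (\<lambda>\<omega>. resid \<nu>0 \<nu>1 \<nu>2 t h c (Y \<omega>)) = 0"
    unfolding R using Y mean q_def by (simp add: prob_space)
  have "expectation (\<lambda>\<omega>. (resid \<nu>0 \<nu>1 \<nu>2 t h c (Y \<omega>))\<^sup>2) \<le> expectation ?B"
    using sq iB le by (intro integral_mono) auto
  also have "\<dots> = 3 * (K2 * expectation (\<lambda>\<omega>. (Y \<omega> - h)\<^sup>2) + 4 * (expectation (\<lambda>\<omega>. (Y \<omega> - h)\<^sup>2) * h\<^sup>2)
      + K1 * expectation (\<lambda>\<omega>. ((Y \<omega>)\<^sup>2 - q)\<^sup>2))"
    using iX iQ by simp
  finally show "expectation (\<lambda>\<omega>. (resid \<nu>0 \<nu>1 \<nu>2 t h c (Y \<omega>))\<^sup>2)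
      \<le> 3 * (K2 * variance Y + 4 * (variance Y * h\<^sup>2) + K1 * variance (\<lambda>\<omega>. (Y \<omega>)\<^sup>2))"
    by (simp add: mean q_def)
qed

text \<open>
  A shrinkage estimate is a convex combination of an observation and a location, both of which are at
  most \<open>max \<bar>Y\<^sub>i\<bar>\<close> in absolute value; hence so is the estimate.
\<close>

lemma integrable_loss_shrink_est:
  assumes p: "1 \<le> p"
    and Y: "\<And>i. i \<in> {1..p} \<Longrightarrow> Y i \<in> borel_measurable M"
    and A: "integrable M (\<lambda>\<omega>. (max_abs p (\<lambda>i. Y i \<omega>))\<^sup>2)"
    and meas: "data_measurable b \<mu>"
    and b: "\<And>\<omega> i. \<omega> \<in> space M \<Longrightarrow> i \<in> {1..p} \<Longrightarrow> b p (sample Y p \<omega>) i \<in> {0..1}"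
    and \<mu>: "\<And>\<omega>. \<omega> \<in> space M \<Longrightarrow> \<bar>\<mu> p (sample Y p \<omega>)\<bar> \<le> max_abs p (sample Y p \<omega>)"
  shows "integrable M (\<lambda>\<omega>. loss p \<theta> (shrink_est Y b \<mu> p \<omega>))"
proof -
  have samp: "sample Y p \<in> M \<rightarrow>\<^sub>M PiM {1..p} (\<lambda>_. borel)"
    unfolding sample_def by (intro measurable_restrict Y)
  have "integrable M (\<lambda>\<omega>. (shrink_est Y b \<mu> p \<omega> i - \<theta> i)\<^sup>2)" if i: "i \<in> {1..p}" for i
  proof (rule Bochner_Integration.integrable_bound)
    show "integrable M (\<lambda>\<omega>. 2 * (max_abs p (\<lambda>i. Y i \<omega>))\<^sup>2 + 2 * (\<theta> i)\<^sup>2)" using A by simp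
    have [measurable]: "Y i \<in> borel_measurable M"
      "(\<lambda>\<omega>. b p (sample Y p \<omega>) i) \<in> borel_measurable M" "(\<lambda>\<omega>. \<mu> p (sample Y p \<omega>)) \<in> borel_measurable M"
      using Y meas p i measurable_compose[OF samp, of "\<lambda>y. b p y i" borel]
        measurable_compose[OF samp, of "\<mu> p" borel]
      unfolding data_measurable_def by auto
    have "shrink_est Y b \<mu> p \<omega> i
        = (1 - b p (sample Y p \<omega>) i) * Y i \<omega> + b p (sample Y p \<omega>) i * \<mu> p (sample Y p \<omega>)" for \<omega>
      using i by (simp add: shrink_est_def shrink_def sample_def)
    note est = this
    show "(\<lambda>\<omega>. (shrink_est Y b \<mu> p \<omega> i - \<theta> i)\<^sup>2) \<in> borel_measurable M"
      unfolding est by measurable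
    show "AE \<omega> in M. norm ((shrink_est Y b \<mu> p \<omega> i - \<theta> i)\<^sup>2)
        \<le> norm (2 * (max_abs p (\<lambda>i. Y i \<omega>))\<^sup>2 + 2 * (\<theta> i)\<^sup>2)"
    proof (rule AE_I2)
      fix \<omega> assume \<omega>: "\<omega> \<in> space M"
      define A B t where "A = max_abs p (\<lambda>i. Y i \<omega>)" and "B = b p (sample Y p \<omega>) i"
        and "t = shrink_est Y b \<mu> p \<omega> i"
      have B: "0 \<le> B" "B \<le> 1" using b[OF \<omega> i] by (auto simp: B_def)
      have "\<bar>t\<bar> \<le> \<bar>(1 - B) * Y i \<omega>\<bar> + \<bar>B * \<mu> p (sample Y p \<omega>)\<bar>"
        unfolding t_def est B_def[symmetric] by (rule abs_triangle_ineq)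
      also have "\<dots> \<le> (1 - B) * A + B * A"
        using B abs_le_max_abs[OF i, of "\<lambda>i. Y i \<omega>"] \<mu>[OF \<omega>]
        by (auto simp: abs_mult A_def max_abs_sample intro!: add_mono mult_left_mono)
      finally have "\<bar>t\<bar> \<le> A" by (simp add: algebra_simps)
      then have "t\<^sup>2 \<le> A\<^sup>2" by (rule abs_le_square_iff[THEN iffD1, OF order_trans, OF _ abs_ge_self])
      moreover have "(t - \<theta> i)\<^sup>2 \<le> 2 * t\<^sup>2 + 2 * (\<theta> i)\<^sup>2"
        using zero_le_power2[of "t + \<theta> i"] by (simp add: power2_eq_square algebra_simps)
      ultimately show "norm ((shrink_est Y b \<mu> p \<omega> i - \<theta> i)\<^sup>2)
          \<le> norm (2 * (max_abs p (\<lambda>i. Y i \<omega>))\<^sup>2 + 2 * (\<theta> i)\<^sup>2)"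
        unfolding A_def[symmetric] t_def[symmetric] by simp
    qed
  qed
  then show ?thesis unfolding loss_def
    by (intro integrable_mult_right Bochner_Integration.integrable_sum) auto
qed

text \<open>
  Both conclusions of the theorem follow from one bound on the excess loss: the first by Markov's
  inequality, the second by integration.
\<close>

lemma domination_up_to_vanishing_expectation:
  fixes f g B :: "nat \<Rightarrow> 'a \<Rightarrow> real"
  assumes le: "\<And>p \<omega>. 1 \<le> p \<Longrightarrow> \<omega> \<in> space M \<Longrightarrow> f p \<omega> \<le> g p \<omega> + B p \<omega>"
    and B0: "\<And>p \<omega>. 0 \<le> B p \<omega>"
    and int: "\<And>p. 1 \<le> p \<Longrightarrow> integrable M (f p)" "\<And>p. 1 \<le> p \<Longrightarrow> integrable M (g p)"
      "\<And>p. 1 \<le> p \<Longrightarrow> integrable M (B p)"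
    and lim: "(\<lambda>p. expectation (B p)) \<longlonglongrightarrow> 0"
  shows "0 < \<epsilon> \<Longrightarrow> (\<lambda>p. prob {\<omega> \<in> space M. f p \<omega> \<ge> g p \<omega> + \<epsilon>}) \<longlonglongrightarrow> 0"
    and "limsup (\<lambda>p. ereal (expectation (f p) - expectation (g p))) \<le> 0"
proof -
  have ev1: "eventually (\<lambda>p. 1 \<le> (p :: nat)) sequentially" by (rule eventually_ge_at_top)
  show "(\<lambda>p. prob {\<omega> \<in> space M. f p \<omega> \<ge> g p \<omega> + \<epsilon>}) \<longlonglongrightarrow> 0" if "0 < \<epsilon>"
  proof (rule tendsto_sandwich[of "\<lambda>_. 0"])
    show "eventually (\<lambda>p. prob {\<omega> \<in> space M. f p \<omega> \<ge> g p \<omega> + \<epsilon>} \<le> expectation (B p) / \<epsilon>) sequentially"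
      using ev1
    proof eventually_elim
      case (elim p)
      have [measurable]: "B p \<in> borel_measurable M" using int(3)[OF elim] by simp
      have "prob {\<omega> \<in> space M. f p \<omega> \<ge> g p \<omega> + \<epsilon>} \<le> prob {\<omega> \<in> space M. B p \<omega> \<ge> \<epsilon>}"
        using le[OF elim] by (intro finite_measure_mono) (fastforce, measurable)
      also have "\<dots> \<le> expectation (B p) / \<epsilon>"
        using int(3)[OF elim] B0 that by (intro integral_Markov_inequality_measure[where A = "{}"]) auto
      finally show ?case .
    qed
    show "(\<lambda>p. expectation (B p) / \<epsilon>) \<longlonglongrightarrow> 0"
      using tendsto_divide[OF lim tendsto_const[of \<epsilon>]] that by simp
  qed auto
  have "limsup (\<lambda>p. ereal (expectation (f p) - expectation (g p))) \<le> limsup (\<lambda>p. ereal (expectation (B p)))"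
  proof (rule Limsup_mono)
    show "eventually (\<lambda>p. ereal (expectation (f p) - expectation (g p)) \<le> ereal (expectation (B p))) sequentially"
      using ev1
    proof eventually_elim
      case (elim p)
      have "expectation (f p) \<le> expectation (\<lambda>\<omega>. g p \<omega> + B p \<omega>)"
        using int[OF elim] le[OF elim] by (intro integral_mono) auto
      then show ?case using int[OF elim] by simp
    qed
  qed
  also have "\<dots> = 0"
    using lim_imp_Limsup[OF trivial_limit_sequentially, of "\<lambda>p. ereal (expectation (B p))" 0] lim
    by (simp add: zero_ereal_def)
  finally show "limsup (\<lambda>p. ereal (expectation (f p) - expectation (g p))) \<le> 0" .
qed

end

section \<open>Asymptotic optimality of the semiparametric estimator\<close>

theorem theorem2p2:
  fixes M :: "'a measure"
    and Y :: "nat \<Rightarrow> 'a \<Rightarrow> real"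
    and \<theta> \<tau> :: "nat \<Rightarrow> real"
    and \<nu>0 \<nu>1 \<nu>2 :: real
    and \<Theta> :: "real set"
    and bSM bhat :: "nat \<Rightarrow> (nat \<Rightarrow> real) \<Rightarrow> nat \<Rightarrow> real"
    and muSM muhat :: "nat \<Rightarrow> (nat \<Rightarrow> real) \<Rightarrow> real"
  assumes prob: "prob_space M"
    and Theta: "\<Theta> \<subseteq> {x. quad_var \<nu>0 \<nu>1 \<nu>2 x \<ge> 0}"
    and theta: "\<And>i. i \<ge> 1 \<Longrightarrow> \<theta> i \<in> \<Theta>"
    and tau_pos: "\<And>i. i \<ge> 1 \<Longrightarrow> \<tau> i > 0"
    and tau_nu2: "\<And>i. i \<ge> 1 \<Longrightarrow> \<tau> i + \<nu>2 \<noteq> 0"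
    and indep: "prob_space.indep_vars M (\<lambda>_. borel) Y {1..}"
    and int1: "\<And>i. i \<ge> 1 \<Longrightarrow> integrable M (Y i)"
    and int2: "\<And>i. i \<ge> 1 \<Longrightarrow> integrable M (\<lambda>\<omega>. (Y i \<omega>)\<^sup>2)"
    and int4: "\<And>i. i \<ge> 1 \<Longrightarrow> integrable M (\<lambda>\<omega>. ((Y i \<omega>)\<^sup>2)\<^sup>2)"
    and mean: "\<And>i. i \<ge> 1 \<Longrightarrow> prob_space.expectation M (Y i) = \<theta> i"
    and var: "\<And>i. i \<ge> 1 \<Longrightarrow> prob_space.variance M (Y i) = quad_var \<nu>0 \<nu>1 \<nu>2 (\<theta> i) / \<tau> i"
    and A: "limsup (\<lambda>p. ereal ((1 / real p) * (\<Sum>i=1..p. prob_space.variance M (Y i)))) < \<infinity>"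
    and B: "limsup (\<lambda>p. ereal ((1 / real p) *
              (\<Sum>i=1..p. prob_space.variance M (Y i) * (\<theta> i)\<^sup>2))) < \<infinity>"
    and C: "limsup (\<lambda>p. ereal ((1 / real p) *
              (\<Sum>i=1..p. prob_space.variance M (\<lambda>\<omega>. (Y i \<omega>)\<^sup>2)))) < \<infinity>"
    and D1: "(SUP i\<in>{1..}. ereal ((\<tau> i / (\<tau> i + \<nu>2))\<^sup>2)) < \<infinity>"
    and D2: "(SUP i\<in>{1..}. ereal ((\<nu>1 / (\<tau> i + \<nu>2))\<^sup>2)) < \<infinity>"
    and E: "\<exists>\<epsilon>>0. limsup (\<lambda>p. ereal ((1 / real p powr (1 - \<epsilon>)) *
              prob_space.expectation M (\<lambda>\<omega>. Max ((\<lambda>i. (Y i \<omega>)\<^sup>2) ` {1..p})))) < \<infinity>"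
    and SM_meas: "data_measurable bSM muSM"
    and SM: "\<And>p \<omega>. p \<ge> 1 \<Longrightarrow> \<omega> \<in> space M \<Longrightarrow>
              is_SM \<nu>0 \<nu>1 \<nu>2 \<Theta> \<tau> p (sample Y p \<omega>) (bSM p (sample Y p \<omega>)) (muSM p (sample Y p \<omega>))"
    and hat_meas: "data_measurable bhat muhat"
    and bhat01: "\<And>p \<omega> i. p \<ge> 1 \<Longrightarrow> \<omega> \<in> space M \<Longrightarrow> i \<in> {1..p} \<Longrightarrow>
              bhat p (sample Y p \<omega>) i \<in> {0..1}"
    and bhat_MON: "\<And>p \<omega>. p \<ge> 1 \<Longrightarrow> \<omega> \<in> space M \<Longrightarrow> MON \<tau> p (bhat p (sample Y p \<omega>))"
    and muhat: "\<And>p \<omega>. p \<ge> 1 \<Longrightarrow> \<omega> \<in> space M \<Longrightarrow>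
              \<bar>muhat p (sample Y p \<omega>)\<bar> \<le> max_abs p (sample Y p \<omega>)"
    and Theta_muhat: "is_interval \<Theta> \<or>
              (\<forall>p\<ge>1. \<forall>\<omega>\<in>space M. muhat p (sample Y p \<omega>) \<in> \<Theta>)"
  shows "(\<forall>\<epsilon>>0. (\<lambda>p. measure M {\<omega> \<in> space M.
              loss p \<theta> (shrink_est Y bSM muSM p \<omega>)
                \<ge> loss p \<theta> (shrink_est Y bhat muhat p \<omega>) + \<epsilon>}) \<longlonglongrightarrow> 0)
       \<and> limsup (\<lambda>p. ereal (risk M p \<theta> (shrink_est Y bSM muSM p)
                              - risk M p \<theta> (shrink_est Y bhat muhat p))) \<le> 0"
proof -
  interpret prob_space M by (rule prob)
  obtain KA where KA: "0 \<le> KA" "eventually (\<lambda>p. (1 / real p) * (\<Sum>i=1..p. variance (Y i)) \<le> KA) sequentially"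
    using limsup_finite_imp_eventually_le[OF A] by blast
  obtain KB where KB: "0 \<le> KB" "eventually (\<lambda>p. (1 / real p) * (\<Sum>i=1..p. variance (Y i) * (\<theta> i)\<^sup>2) \<le> KB) sequentially"
    using limsup_finite_imp_eventually_le[OF B] by blast
  obtain KC where KC: "0 \<le> KC" "eventually (\<lambda>p. (1 / real p) * (\<Sum>i=1..p. variance (\<lambda>\<omega>. (Y i \<omega>)\<^sup>2)) \<le> KC) sequentially"
    using limsup_finite_imp_eventually_le[OF C] by blast
  obtain K1 where K1: "0 \<le> K1" "\<forall>i\<in>{1..}. (\<tau> i / (\<tau> i + \<nu>2))\<^sup>2 \<le> K1"
    using SUP_finite_imp_le[OF D1] by blast
  obtain K2 where K2: "0 \<le> K2" "\<forall>i\<in>{1..}. (\<nu>1 / (\<tau> i + \<nu>2))\<^sup>2 \<le> K2"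
    using SUP_finite_imp_le[OF D2] by blast
  obtain \<delta> where \<delta>: "0 < \<delta>" and E': "limsup (\<lambda>p. ereal ((1 / real p powr (1 - \<delta>)) *
      expectation (\<lambda>\<omega>. Max ((\<lambda>i. (Y i \<omega>)\<^sup>2) ` {1..p})))) < \<infinity>"
    using E by blast
  obtain KE where KE: "0 \<le> KE" "eventually (\<lambda>p. (1 / real p powr (1 - \<delta>)) *
      expectation (\<lambda>\<omega>. Max ((\<lambda>i. (Y i \<omega>)\<^sup>2) ` {1..p})) \<le> KE) sequentially"
    using limsup_finite_imp_eventually_le[OF E'] by blast
  define KU where "KU = 3 * (K2 * KA + 4 * KB + K1 * KC)"
  obtain \<sigma> where \<sigma>: "\<And>p. bij_betw (\<sigma> p) {..<p} {1..p}"
      "\<And>p i j. i \<le> j \<Longrightarrow> j < p \<Longrightarrow> \<tau> (\<sigma> p i) \<le> \<tau> (\<sigma> p j)"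
    using ex_sorting_enumeration[where \<tau> = \<tau>] by metis

  define U where "U c i \<omega> = resid \<nu>0 \<nu>1 \<nu>2 (\<tau> i) (\<theta> i) c (Y i \<omega>)" for c i \<omega>
  define X where "X i \<omega> = Y i \<omega> - \<theta> i" for i \<omega>
  define DU where "DU p \<omega> = max_psum p (\<lambda>j. U 1 (\<sigma> p j) \<omega>)" for p \<omega>
  define DX where "DX p \<omega> = max_psum p (\<lambda>j. X (\<sigma> p j) \<omega>)" for p \<omega>
  define SZ where "SZ p \<omega> = (\<Sum>i=1..p. U 2 i \<omega>)" for p \<omega>
  define Ymax where "Ymax p \<omega> = max_abs p (\<lambda>i. Y i \<omega>)" for p \<omega>

  have Y_meas [measurable]: "Y i \<in> borel_measurable M" if "1 \<le> i" for i using int1[OF that] by simp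
  have ind: "indep_vars (\<lambda>_. borel) Y {1..p}" for p by (rule indep_vars_subset[OF indep]) auto
  have indU: "indep_vars (\<lambda>_. borel) (U c) {1..p}" for c p
    unfolding U_def[abs_def] resid_def by (rule indep_vars_compose2[OF ind]) measurable
  have indX: "indep_vars (\<lambda>_. borel) X {1..p}" for p
    unfolding X_def[abs_def] by (rule indep_vars_compose2[OF ind]) measurable
  have U: "integrable M (\<lambda>\<omega>. (U c i \<omega>)\<^sup>2)" "expectation (U c i) = 0"
      "expectation (\<lambda>\<omega>. (U c i \<omega>)\<^sup>2) \<le> 3 * (K2 * variance (Y i) + 4 * (variance (Y i) * (\<theta> i)\<^sup>2)
         + K1 * variance (\<lambda>\<omega>. (Y i \<omega>)\<^sup>2))" if "1 \<le> i" "c\<^sup>2 \<le> 4" for c i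
    using resid_moments[OF int1[OF that(1)] int2[OF that(1)] int4[OF that(1)] mean[OF that(1)] var[OF that(1)]
        _ _ that(2), of K1 K2] K1(2) K2(2) that(1) unfolding U_def[abs_def] by auto
  have X: "integrable M (\<lambda>\<omega>. (X i \<omega>)\<^sup>2)" "expectation (X i) = 0"
      "expectation (\<lambda>\<omega>. (X i \<omega>)\<^sup>2) = variance (Y i)" if "1 \<le> i" for i
    using int1[OF that] int2[OF that] mean[OF that] unfolding X_def[abs_def]
    by (simp_all add: power2_diff prob_space)

  have DU: "integrable M (\<lambda>\<omega>. (DU p \<omega>)\<^sup>2)"
      "expectation (\<lambda>\<omega>. (DU p \<omega>)\<^sup>2) \<le> 4 * (\<Sum>i=1..p. expectation (\<lambda>\<omega>. (U 1 i \<omega>)\<^sup>2))" for p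
    unfolding DU_def using L2_maximal_enumeration(1,2)[OF indU _ _ \<sigma>(1), of p 1] U by auto
  have DX: "integrable M (\<lambda>\<omega>. (DX p \<omega>)\<^sup>2)"
      "expectation (\<lambda>\<omega>. (DX p \<omega>)\<^sup>2) \<le> 4 * (\<Sum>i=1..p. variance (Y i))" for p
    unfolding DX_def using L2_maximal_enumeration(1,2)[OF indX _ _ \<sigma>(1), of p] X by auto
  have SZ: "integrable M (\<lambda>\<omega>. (SZ p \<omega>)\<^sup>2)"
      "expectation (\<lambda>\<omega>. (SZ p \<omega>)\<^sup>2) = (\<Sum>i=1..p. expectation (\<lambda>\<omega>. (U 2 i \<omega>)\<^sup>2))" for p
    unfolding SZ_def using L2_maximal_enumeration(3,4)[OF indU _ _ \<sigma>(1), of p 2] U by auto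
  have Ymax_meas: "(\<lambda>\<omega>. Ymax p \<omega>) \<in> borel_measurable M" for p
    unfolding Ymax_def max_abs_def by (intro borel_measurable_Max borel_measurable_abs Y_meas) auto
  have int_sum: "integrable M (\<lambda>\<omega>. \<Sum>i=1..p. (Y i \<omega>)\<^sup>2)" for p
    using int2 by (intro Bochner_Integration.integrable_sum) auto
  have int_Max: "integrable M (\<lambda>\<omega>. Max ((\<lambda>i. (Y i \<omega>)\<^sup>2) ` {1..p}))" if "1 \<le> p" for p
  proof (rule Bochner_Integration.integrable_bound[OF int_sum[of p]])
    show "(\<lambda>\<omega>. Max ((\<lambda>i. (Y i \<omega>)\<^sup>2) ` {1..p})) \<in> borel_measurable M"
      by (intro borel_measurable_Max borel_measurable_power Y_meas) auto
    have "0 \<le> Max ((\<lambda>i. (Y i \<omega>)\<^sup>2) ` {1..p})" for \<omega>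
      using max_abs_sq_le_Max[OF that] by (rule order_trans[OF zero_le_power2])
    then show "AE \<omega> in M. norm (Max ((\<lambda>i. (Y i \<omega>)\<^sup>2) ` {1..p})) \<le> norm (\<Sum>i=1..p. (Y i \<omega>)\<^sup>2)"
      using Max_sq_le_sum[OF that] by (intro AE_I2) (auto intro: order_trans[OF _ abs_ge_self])
  qed
  have Ymax: "integrable M (\<lambda>\<omega>. (Ymax p \<omega>)\<^sup>2)"
      "expectation (\<lambda>\<omega>. (Ymax p \<omega>)\<^sup>2) \<le> expectation (\<lambda>\<omega>. Max ((\<lambda>i. (Y i \<omega>)\<^sup>2) ` {1..p}))"
    if p: "1 \<le> p" for p
  proof -
    show i: "integrable M (\<lambda>\<omega>. (Ymax p \<omega>)\<^sup>2)"
    proof (rule Bochner_Integration.integrable_bound[OF int_Max[OF p]])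
      show "(\<lambda>\<omega>. (Ymax p \<omega>)\<^sup>2) \<in> borel_measurable M" by (intro borel_measurable_power Ymax_meas)
      show "AE \<omega> in M. norm ((Ymax p \<omega>)\<^sup>2) \<le> norm (Max ((\<lambda>i. (Y i \<omega>)\<^sup>2) ` {1..p}))"
        using order_trans[OF max_abs_sq_le_Max[OF p] abs_ge_self]
        by (intro AE_I2) (simp add: Ymax_def del: One_nat_def)
    qed
    show "expectation (\<lambda>\<omega>. (Ymax p \<omega>)\<^sup>2) \<le> expectation (\<lambda>\<omega>. Max ((\<lambda>i. (Y i \<omega>)\<^sup>2) ` {1..p}))"
      using max_abs_sq_le_Max[OF p] by (intro integral_mono i int_Max p) (auto simp: Ymax_def)
  qed

  \<comment> \<open>The bound of \<open>loss_comparison\<close> after \<open>young_with_power\<close>: exponent \<open>1/2\<close> pairs a sum of second moment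
    \<open>O(p)\<close> with the constant 1, and \<open>1 - \<delta>/2\<close> pairs a second moment \<open>O(p powr (1 - \<delta>))\<close> with one \<open>O(p)\<close>.\<close>
  define H where "H p \<omega> = 3 * real p powr (- 1 / 2)
     + ((SZ p \<omega>)\<^sup>2 + 2 * (DU p \<omega>)\<^sup>2) * real p powr (- 3 / 2)
     + 6 * ((Ymax p \<omega>)\<^sup>2 * real p powr (- (1 - \<delta> / 2)) + (DX p \<omega>)\<^sup>2 * real p powr (- 1 - \<delta> / 2))" for p \<omega>
  have H0: "0 \<le> H p \<omega>" for p \<omega> unfolding H_def by (intro add_nonneg_nonneg mult_nonneg_nonneg) auto
  have H_int: "integrable M (H p)" if "1 \<le> p" for p
    unfolding H_def[abs_def] using SZ(1) DU(1) DX(1) Ymax(1)[OF that] by auto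

  have muSM: "\<bar>muSM p (sample Y p \<omega>)\<bar> \<le> max_abs p (sample Y p \<omega>)"
    and bSM01: "\<And>i. i \<in> {1..p} \<Longrightarrow> bSM p (sample Y p \<omega>) i \<in> {0..1}"
    if "1 \<le> p" "\<omega> \<in> space M" for p \<omega>
    using SM[OF that] unfolding is_SM_def is_arg_min_def by auto

  have le: "loss p \<theta> (shrink_est Y bSM muSM p \<omega>) \<le> loss p \<theta> (shrink_est Y bhat muhat p \<omega>) + H p \<omega>"
    if p: "1 \<le> p" and \<omega>: "\<omega> \<in> space M" for p \<omega>
  proof -
    have sample: "sample Y p \<omega> i = Y i \<omega>" if "i \<in> {1..p}" for i using that by (simp add: sample_def)
    have compare: "loss p \<theta> (shrink_est Y bSM muSM p \<omega>) \<le> loss p \<theta> (shrink_est Y bhat muhat p \<omega>)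
      + (2 * \<bar>\<Sum>i=1..p. resid \<nu>0 \<nu>1 \<nu>2 (\<tau> i) (\<theta> i) 2 (sample Y p \<omega> i)\<bar> + 4 * DU p \<omega>
         + 12 * (max_abs p (sample Y p \<omega>) * DX p \<omega>)) / real p"
      unfolding shrink_est_def
    proof (rule loss_comparison[OF p _ _ _ SM[OF p \<omega>]])
      fix b assume b: "MON \<tau> p b" "\<forall>i\<in>{1..p}. b i \<in> {0..1}"
      show "\<bar>\<Sum>i=1..p. b i * resid \<nu>0 \<nu>1 \<nu>2 (\<tau> i) (\<theta> i) 1 (sample Y p \<omega> i)\<bar> \<le> DU p \<omega>"
        using MON_weighted_sum_le[OF \<sigma> b, of "\<lambda>i. U 1 i \<omega>"] sample
        unfolding DU_def U_def by simp
      show "\<bar>\<Sum>i=1..p. b i * (sample Y p \<omega> i - \<theta> i)\<bar> \<le> DX p \<omega>"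
        using MON_weighted_sum_le[OF \<sigma> b, of "\<lambda>i. X i \<omega>"] sample
        unfolding DX_def X_def by simp
    qed (use tau_pos tau_nu2 theta bhat01[OF p \<omega>] bhat_MON[OF p \<omega>] muhat[OF p \<omega>] Theta_muhat p \<omega>
         in \<open>auto simp: less_imp_neq[symmetric]\<close>)
    have SZ_eq: "(\<Sum>i=1..p. resid \<nu>0 \<nu>1 \<nu>2 (\<tau> i) (\<theta> i) 2 (sample Y p \<omega> i)) = SZ p \<omega>"
      using sample by (simp add: SZ_def U_def)
    have Ymax_eq: "max_abs p (sample Y p \<omega>) = Ymax p \<omega>" by (simp add: Ymax_def max_abs_sample)
    have "(2 * \<bar>SZ p \<omega>\<bar> + 4 * DU p \<omega> + 12 * (Ymax p \<omega> * DX p \<omega>)) / real p \<le> H p \<omega>"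
    proof -
      have "2 * \<bar>SZ p \<omega>\<bar> / real p \<le> real p powr (- 1 / 2) + (SZ p \<omega>)\<^sup>2 * real p powr (- 3 / 2)"
        "2 * DU p \<omega> / real p \<le> real p powr (- 1 / 2) + (DU p \<omega>)\<^sup>2 * real p powr (- 3 / 2)"
        "2 * (Ymax p \<omega> * DX p \<omega>) / real p
          \<le> (Ymax p \<omega>)\<^sup>2 * real p powr (- (1 - \<delta> / 2)) + (DX p \<omega>)\<^sup>2 * real p powr (- 1 - \<delta> / 2)"
        using young_with_power[of p 1 "\<bar>SZ p \<omega>\<bar>" "1/2"] young_with_power[of p 1 "DU p \<omega>" "1/2"]
          young_with_power[of p "Ymax p \<omega>" "DX p \<omega>" "1 - \<delta> / 2"] p by simp_all
      moreover have "(2 * \<bar>SZ p \<omega>\<bar> + 4 * DU p \<omega> + 12 * (Ymax p \<omega> * DX p \<omega>)) / real p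
          = 2 * \<bar>SZ p \<omega>\<bar> / real p + 2 * (2 * DU p \<omega> / real p) + 6 * (2 * (Ymax p \<omega> * DX p \<omega>) / real p)"
        by (simp add: add_divide_distrib)
      moreover have "t \<le> 3 * P + (S + 2 * D) + 6 * R"
        if "a \<le> P + S" "b \<le> P + D" "c \<le> R" "t = a + 2 * b + 6 * c" for t a b c P S D R :: real
        using that by linarith
      ultimately show ?thesis unfolding H_def distrib_right[of "(SZ p \<omega>)\<^sup>2"] mult.assoc by blast
    qed
    then show ?thesis
      by (rule order_trans[OF compare[unfolded SZ_eq Ymax_eq] add_left_mono])
  qed

  have EH: "eventually (\<lambda>p. expectation (H p) \<le>
      (3 + 9 * KU) * real p powr (- 1 / 2) + 6 * (KE + 4 * KA) * real p powr (- \<delta> / 2)) sequentially"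
    using KA(2) KB(2) KC(2) KE(2) eventually_ge_at_top[of 1]
  proof eventually_elim
    case (elim p)
    have p: "0 < real p" using elim(5) by simp
    have A': "(\<Sum>i=1..p. variance (Y i)) \<le> KA * p" and B': "(\<Sum>i=1..p. variance (Y i) * (\<theta> i)\<^sup>2) \<le> KB * p"
      and C': "(\<Sum>i=1..p. variance (\<lambda>\<omega>. (Y i \<omega>)\<^sup>2)) \<le> KC * p"
      using elim(1-3) p by (simp_all add: field_simps)
    have EU: "(\<Sum>i=1..p. expectation (\<lambda>\<omega>. (U c i \<omega>)\<^sup>2)) \<le> KU * p" if "c\<^sup>2 \<le> 4" for c
    proof -
      have "(\<Sum>i=1..p. expectation (\<lambda>\<omega>. (U c i \<omega>)\<^sup>2)) \<le> (\<Sum>i=1..p. 3 * (K2 * variance (Y i)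
          + 4 * (variance (Y i) * (\<theta> i)\<^sup>2) + K1 * variance (\<lambda>\<omega>. (Y i \<omega>)\<^sup>2)))"
        using U(3) that by (intro sum_mono) auto
      also have "\<dots> = 3 * (K2 * (\<Sum>i=1..p. variance (Y i)) + 4 * (\<Sum>i=1..p. variance (Y i) * (\<theta> i)\<^sup>2)
          + K1 * (\<Sum>i=1..p. variance (\<lambda>\<omega>. (Y i \<omega>)\<^sup>2)))"
        by (simp only: sum_distrib_left[symmetric] sum.distrib)
      also have "\<dots> \<le> 3 * (K2 * (KA * p) + 4 * (KB * p) + K1 * (KC * p))"
        using A' B' C' K1(1) K2(1) by (intro mult_left_mono add_mono) auto
      finally show ?thesis by (simp add: KU_def algebra_simps)
    qed
    have EY: "expectation (\<lambda>\<omega>. (Ymax p \<omega>)\<^sup>2) \<le> KE * real p powr (1 - \<delta>)"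
      using Ymax(2)[OF elim(5)] elim(4) p by (simp add: field_simps)
    have pw: "real p * real p powr (- 3 / 2) = real p powr (- 1 / 2)"
      "real p powr (1 - \<delta>) * real p powr (- (1 - \<delta> / 2)) = real p powr (- \<delta> / 2)"
      "real p * real p powr (- 1 - \<delta> / 2) = real p powr (- \<delta> / 2)"
    proof -
      have mult_p: "real p * real p powr a = real p powr (1 + a)" for a using p by (simp add: powr_add)
      show "real p * real p powr (- 3 / 2) = real p powr (- 1 / 2)"
        "real p * real p powr (- 1 - \<delta> / 2) = real p powr (- \<delta> / 2)"
        unfolding mult_p by simp_all
      have "1 - \<delta> + - (1 - \<delta> / 2) = - \<delta> / 2" by (simp add: field_simps)
      then show "real p powr (1 - \<delta>) * real p powr (- (1 - \<delta> / 2)) = real p powr (- \<delta> / 2)"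
        unfolding powr_add[symmetric] by simp
    qed
    have "expectation (H p) = 3 * real p powr (- 1 / 2)
      + (expectation (\<lambda>\<omega>. (SZ p \<omega>)\<^sup>2) + 2 * expectation (\<lambda>\<omega>. (DU p \<omega>)\<^sup>2)) * real p powr (- 3 / 2)
      + 6 * (expectation (\<lambda>\<omega>. (Ymax p \<omega>)\<^sup>2) * real p powr (- (1 - \<delta> / 2))
             + expectation (\<lambda>\<omega>. (DX p \<omega>)\<^sup>2) * real p powr (- 1 - \<delta> / 2))"
      unfolding H_def[abs_def] using SZ(1) DU(1) DX(1) Ymax(1)[OF elim(5)] by (simp add: prob_space)
    also have "\<dots> \<le> 3 * real p powr (- 1 / 2)
      + (KU * p + 2 * (4 * (KU * p))) * real p powr (- 3 / 2)
      + 6 * (KE * real p powr (1 - \<delta>) * real p powr (- (1 - \<delta> / 2)) + 4 * (KA * p) * real p powr (- 1 - \<delta> / 2))"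
      using SZ(2)[of p] DU(2)[of p] DX(2)[of p] EU[of 1] EU[of 2] A' EY
      by (intro add_mono mult_left_mono mult_right_mono order_refl) auto
    also have "\<dots> = 3 * real p powr (- 1 / 2) + 9 * KU * (real p * real p powr (- 3 / 2))
      + 6 * (KE * (real p powr (1 - \<delta>) * real p powr (- (1 - \<delta> / 2))) + 4 * KA * (real p * real p powr (- 1 - \<delta> / 2)))"
      by (simp add: algebra_simps)
    also have "\<dots> = (3 + 9 * KU) * real p powr (- 1 / 2) + 6 * (KE + 4 * KA) * real p powr (- \<delta> / 2)"
      unfolding pw by (simp add: algebra_simps)
    finally show ?case .
  qed
  have powr_lim: "(\<lambda>p. real p powr a) \<longlonglongrightarrow> 0" if "a < 0" for a
    by (rule tendsto_neg_powr[OF that filterlim_real_sequentially])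
  have "(\<lambda>p. expectation (H p)) \<longlonglongrightarrow> 0"
  proof (rule tendsto_sandwich[OF _ EH tendsto_const])
    show "eventually (\<lambda>p. 0 \<le> expectation (H p)) sequentially"
      using H0 by (intro always_eventually allI integral_nonneg) auto
    show "(\<lambda>p. (3 + 9 * KU) * real p powr (- 1 / 2) + 6 * (KE + 4 * KA) * real p powr (- \<delta> / 2)) \<longlonglongrightarrow> 0"
      using tendsto_add[OF tendsto_mult_left[OF powr_lim[of "- 1 / 2"], of "3 + 9 * KU"]
          tendsto_mult_left[OF powr_lim[of "- \<delta> / 2"], of "6 * (KE + 4 * KA)"]] \<delta> by simp
  qed
  note dom = domination_up_to_vanishing_expectation[OF le H0 _ _ H_int this]
  have Ysq: "integrable M (\<lambda>\<omega>. (max_abs p (\<lambda>i. Y i \<omega>))\<^sup>2)" if "1 \<le> p" for p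
    using Ymax(1)[OF that] by (simp add: Ymax_def)
  have int_SM: "integrable M (\<lambda>\<omega>. loss p \<theta> (shrink_est Y bSM muSM p \<omega>))" if "1 \<le> p" for p
    using muSM[OF that] bSM01[OF that] Y_meas
    by (intro integrable_loss_shrink_est[OF that _ Ysq[OF that] SM_meas]) auto
  have int_hat: "integrable M (\<lambda>\<omega>. loss p \<theta> (shrink_est Y bhat muhat p \<omega>))" if "1 \<le> p" for p
    using muhat[OF that] bhat01[OF that] Y_meas
    by (intro integrable_loss_shrink_est[OF that _ Ysq[OF that] hat_meas]) auto
  show ?thesis
    using dom[OF _ _ int_SM int_hat] unfolding risk_def by blast
qed

end
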